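(* Let $n\ge2$ and let $r_1=\cdots=r_n=r\neq0$. Then, for the canonical probe $|\psi_{\bm r}\rangle$ with this uniform squeezing spectrum, $F_{ij}^{\mathrm{bsY}}=0$ for every $1\le i<j\le n$, so all $n(n-1)/2$ beam-splitter directions $\hat g_{ij}^{\mathrm{bsY}}$ are Fisher-null (locally unidentifiable), while the Fisher weights $F_j^{\mathrm{rot}}$ ($1\le j\le n$) of all phase rotations and $F_{ij}^{\mathrm{bsX}}$ ($1\le i<j\le n$) of all sum-root beam-splitter channels are strictly positive.
   Context: Bosonic modes: on the Fock space of $n$ bosonic modes let $\hat a_j,\hat a_j^\dagger$ be the annihilation and creation operators, $[\hat a_j,\hat a_k^\dagger]=\delta_{jk}$, and $|0\rangle$ the vacuum. For $\bm r\in\mathbb R^n$ the canonical probe is $|\psi_{\bm r}\rangle=\hat S(\bm r)|0\rangle$ with $\hat S(\bm r)=\prod_{j=1}^n \exp\!\big[\tfrac12 r_j(\hat a_j^2-\hat a_j^{\dagger 2})\big]$. Passive generators: $\hat g_j^{\mathrm{rot}}=\hat a_j^\dagger\hat a_j$; $\hat g_{jk}^{\mathrm{bsX}}=\hat a_j^\dagger\hat a_k+\hat a_k^\dagger\hat a_j$ and $\hat g_{jk}^{\mathrm{bsY}}=-i(\hat a_j^\dagger\hat a_k-\hat a_k^\dagger\hat a_j)$ for $j<k$. The passive Fisher matrix is $F_{\mu\nu}=2\langle\{\Delta\hat g_\mu,\Delta\hat g_\nu\}\rangle$ with $\Delta\hat g_\mu=\hat g_\mu-\langle\hat g_\mu\rangle$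 and expectation values in $|\psi_{\bm r}\rangle$; $F_j^{\mathrm{rot}},F_{jk}^{\mathrm{bsX}},F_{jk}^{\mathrm{bsY}}$ denote its diagonal entries for the corresponding generators. A generator is Fisher-null when its basis direction lies in the kernel of the (positive semidefinite) Fisher matrix, equivalently when its diagonal entry vanishes. *)

theory Defs
  imports "HOL-Analysis.Analysis" "HOL-Library.Complex_Order"
begin

text \<open>
  The modes are the elements of a finite linearly ordered type \<open>'n\<close>, so \<open>n = CARD('n)\<close>.
  A vector of the Fock space is given by its coefficients in the orthonormal basis of number
  states, which is indexed by the occupation numbers \<open>'n \<Rightarrow> nat\<close>; the Fock space itself is the
  set of square-summable coefficient functions. The (unbounded) ladder operators act formally on
  all coefficient functions; where the domain matters it is made explicit.
\<close>

type_synonym 'n state = "('n \<Rightarrow> nat) \<Rightarrow> complex"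
type_synonym 'n oper = "'n state \<Rightarrow> 'n state"

definition fock :: "'n state set" where
  "fock = {\<psi>. (\<lambda>m. (cmod (\<psi> m))\<^sup>2) summable_on UNIV}"

definition fock_inner :: "'n state \<Rightarrow> 'n state \<Rightarrow> complex" where
  "fock_inner \<phi> \<psi> = (\<Sum>\<^sub>\<infinity>m. cnj (\<phi> m) * \<psi> m)"

definition fock_norm :: "'n state \<Rightarrow> real" where
  "fock_norm \<psi> = sqrt (\<Sum>\<^sub>\<infinity>m. (cmod (\<psi> m))\<^sup>2)"

definition vacuum :: "'n state" where
  "vacuum = (\<lambda>m. if m = (\<lambda>_. 0) then 1 else 0)"

definition ann :: "'n \<Rightarrow> 'n oper" where
  "ann j \<psi> = (\<lambda>m. complex_of_real (sqrt (real (m j + 1))) * \<psi> (m(j := m j + 1)))"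

text \<open>The truncated subtraction at \<open>m j = 0\<close> is harmless because the factor vanishes there.\<close>

definition cre :: "'n \<Rightarrow> 'n oper" where
  "cre j \<psi> = (\<lambda>m. complex_of_real (sqrt (real (m j))) * \<psi> (m(j := m j - 1)))"

lemma canonical_commutation:
  "ann j (cre k \<psi>) m - cre k (ann j \<psi>) m = (if j = k then \<psi> m else 0)"
proof (cases "j = k")
  case True
  have sq: "complex_of_real (sqrt (real x)) * (complex_of_real (sqrt (real x)) * z) = of_nat x * z"
    for x :: nat and z
    by (simp add: mult.assoc[symmetric] flip: of_real_mult)
  have "ann k (cre k \<psi>) m = of_nat (m k + 1) * \<psi> m"
    using sq[of "m k + 1" "\<psi> m"] by (simp add: ann_def cre_def)
  moreover have "cre k (ann k \<psi>) m = of_nat (m k) * \<psi> m"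
    using sq[of "m k" "\<psi> m"] by (cases "m k = 0") (simp_all add: ann_def cre_def fun_upd_idem)
  ultimately show ?thesis
    using True by (simp add: algebra_simps)
next
  case False
  then show ?thesis
    by (simp add: ann_def cre_def fun_upd_twist)
qed

lemma ann_vacuum: "ann j vacuum = (\<lambda>_. 0)"
  by (auto simp: ann_def vacuum_def fun_eq_iff split: if_splits)

text \<open>
  The exponential \<open>e\<^sup>A\<close> of an unbounded skew-adjoint operator \<open>A\<close>, i.e. the value at time one of
  the unitary group generated by \<open>A\<close>. On the domain of \<open>A\<close> the orbit \<open>t \<mapsto> e\<^bsup>tA\<^esup>\<psi>\<close> is the
  norm-differentiable solution of \<open>u' = A u\<close>, \<open>u 0 = \<psi>\<close>; the operator is extended to the whole
  Fock space by continuity. (The power series is not a possible definition: for the squeezing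
  generators below it diverges on the vacuum when the squeezing parameter is large.)
  The domain is the maximal one; the squeezing generators are essentially skew-adjoint on the
  finite-particle vectors, so this is the domain of their closure.
\<close>

definition op_domain :: "'n oper \<Rightarrow> 'n state set" where
  "op_domain A = {\<psi> \<in> fock. A \<psi> \<in> fock}"

definition orbit :: "'n oper \<Rightarrow> (real \<Rightarrow> 'n state) \<Rightarrow> bool" where
  "orbit A u \<longleftrightarrow>
     (\<forall>t. u t \<in> op_domain A) \<and>
     (\<forall>t. ((\<lambda>h. fock_norm (\<lambda>m. (u (t + h) m - u t m) / complex_of_real h - A (u t) m))
            \<longlongrightarrow> 0) (at 0))"

definition op_exp :: "'n oper \<Rightarrow> 'n oper" where
  "op_exp A \<psi> = (THE \<phi>. \<phi> \<in> fock \<and>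
     (\<exists>u :: nat \<Rightarrow> real \<Rightarrow> 'n state.
        (\<forall>k. orbit A (u k)) \<and>
        (\<lambda>k. fock_norm (\<lambda>m. u k 0 m - \<psi> m)) \<longlonglongrightarrow> 0 \<and>
        (\<lambda>k. fock_norm (\<lambda>m. u k 1 m - \<phi> m)) \<longlonglongrightarrow> 0))"

definition squeeze_gen :: "'n \<Rightarrow> real \<Rightarrow> 'n oper" where
  "squeeze_gen j s \<psi> =
     (\<lambda>m. complex_of_real (s / 2) * (ann j (ann j \<psi>) m - cre j (cre j \<psi>) m))"

definition squeeze :: "real ^ 'n :: {finite, linorder} \<Rightarrow> 'n oper" where
  "squeeze r = foldr (\<lambda>j T. op_exp (squeeze_gen j (r $ j)) \<circ> T)
                 (sorted_list_of_set (UNIV :: 'n set)) id"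

definition probe :: "real ^ 'n :: {finite, linorder} \<Rightarrow> 'n state" where
  "probe r = squeeze r vacuum"

datatype 'n passive_gen = Rot 'n | BsX 'n 'n | BsY 'n 'n

definition bsY_directions :: "'n :: linorder passive_gen set" where
  "bsY_directions = {BsY j k | j k. j < k}"

definition passive_basis :: "'n :: linorder passive_gen set" where
  "passive_basis = range Rot \<union> {BsX j k | j k. j < k} \<union> bsY_directions"

fun gen_op :: "'n passive_gen \<Rightarrow> 'n oper" where
  "gen_op (Rot j) \<psi> = cre j (ann j \<psi>)"
| "gen_op (BsX j k) \<psi> = (\<lambda>m. cre j (ann k \<psi>) m + cre k (ann j \<psi>) m)"
| "gen_op (BsY j k) \<psi> = (\<lambda>m. - \<i> * (cre j (ann k \<psi>) m - cre k (ann j \<psi>) m))"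

definition expect :: "'n state \<Rightarrow> 'n oper \<Rightarrow> complex" where
  "expect \<psi> T = fock_inner \<psi> (T \<psi>)"

definition fluct :: "'n state \<Rightarrow> 'n oper \<Rightarrow> 'n oper" where
  "fluct \<psi> T \<phi> = (\<lambda>m. T \<phi> m - expect \<psi> T * \<phi> m)"

definition anticomm :: "'n oper \<Rightarrow> 'n oper \<Rightarrow> 'n oper" where
  "anticomm S T \<phi> = (\<lambda>m. S (T \<phi>) m + T (S \<phi>) m)"

definition fisher ::
  "real ^ 'n :: {finite, linorder} \<Rightarrow> 'n passive_gen \<Rightarrow> 'n passive_gen \<Rightarrow> complex" where
  "fisher r \<mu> \<nu> =
     2 * expect (probe r)
           (anticomm (fluct (probe r) (gen_op \<mu>)) (fluct (probe r) (gen_op \<nu>)))"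

text \<open>The basis direction \<open>\<kappa>\<close> lies in the kernel of the Fisher matrix over all passive generators.\<close>

definition fisher_null :: "real ^ 'n :: {finite, linorder} \<Rightarrow> 'n passive_gen \<Rightarrow> bool" where
  "fisher_null r \<kappa> \<longleftrightarrow> \<kappa> \<in> passive_basis \<and>
     (\<forall>\<mu> \<in> passive_basis. (\<Sum>\<nu> \<in> passive_basis. fisher r \<mu> \<nu> * (if \<nu> = \<kappa> then 1 else 0)) = 0)"

end

theory Submission
  imports Defs
begin

text \<open>
  The squeezed product states \<open>gauss x\<close>, with amplitudes \<open>sq_coeff (x i)\<close> in mode \<open>i\<close>, form an
  explicit orbit \<open>t \<mapsto> gauss (x(j := x j + t * s))\<close> of \<open>squeeze_gen j s\<close>; its difference quotients
  converge in norm because the second derivatives of the amplitudes decay geometrically, locally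
  uniformly in \<open>t\<close>. The generator is skew on its maximal domain, so the difference of two orbits has
  constant norm. Hence \<open>op_exp\<close> is determined by this orbit, and the probe is \<open>gauss\<close> of the squeezing
  vector.

  On this state \<open>ann j\<close> acts as \<open>- tanh (r j)\<close> times \<open>cre j\<close>. With equal squeezing both terms of a
  \<open>BsY\<close> generator therefore become the same multiple of \<open>cre i (cre j \<psi>)\<close> and cancel, so the generator
  annihilates the probe. For the other generators the Fisher weight is four times the squared norm of
  the centred generator applied to the probe, and a single nonzero amplitude shows positivity.
\<close>

section \<open>Square-summable states\<close>

lemma fock_add:
  assumes "\<phi> \<in> fock" "\<psi> \<in> fock"
  shows "(\<lambda>m. \<phi> m + \<psi> m) \<in> fock"
proof -
  have "(\<lambda>m. 2 * (cmod (\<phi> m))\<^sup>2 + 2 * (cmod (\<psi> m))\<^sup>2) summable_on UNIV"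
    using assms by (auto simp: fock_def intro!: summable_on_add summable_on_cmult_right)
  moreover have "(cmod (\<phi> m + \<psi> m))\<^sup>2 \<le> 2 * (cmod (\<phi> m))\<^sup>2 + 2 * (cmod (\<psi> m))\<^sup>2" for m
  proof -
    have "(cmod (\<phi> m + \<psi> m))\<^sup>2 \<le> (cmod (\<phi> m) + cmod (\<psi> m))\<^sup>2"
      by (intro power_mono norm_triangle_ineq) auto
    also have "\<dots> \<le> 2 * (cmod (\<phi> m))\<^sup>2 + 2 * (cmod (\<psi> m))\<^sup>2"
      using sum_squares_bound[of "cmod (\<phi> m)" "cmod (\<psi> m)"] by (simp add: power2_sum)
    finally show ?thesis .
  qed
  ultimately show ?thesis
    unfolding fock_def by (auto intro: summable_on_comparison_test)
qed

lemma fock_scale: "\<psi> \<in> fock \<Longrightarrow> (\<lambda>m. c * \<psi> m) \<in> fock"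
  by (auto simp: fock_def norm_mult power_mult_distrib intro!: summable_on_cmult_right)

lemma fock_diff:
  assumes "\<phi> \<in> fock" "\<psi> \<in> fock"
  shows "(\<lambda>m. \<phi> m - \<psi> m) \<in> fock"
  using fock_add[OF assms(1) fock_scale[OF assms(2), of "-1"]] by simp

lemma fock_norm_nonneg: "0 \<le> fock_norm \<psi>"
  by (simp add: fock_norm_def infsum_nonneg)

lemma fock_norm_sq: "(fock_norm \<psi>)\<^sup>2 = (\<Sum>\<^sub>\<infinity>m. (cmod (\<psi> m))\<^sup>2)"
  by (simp add: fock_norm_def infsum_nonneg)

lemma fock_norm_scale: "fock_norm (\<lambda>m. c * \<psi> m) = cmod c * fock_norm \<psi>"
  by (simp add: fock_norm_def norm_mult power_mult_distrib infsum_cmult_right' real_sqrt_mult)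

lemma L2_set_le_fock_norm:
  assumes "\<psi> \<in> fock" "finite F"
  shows "L2_set (\<lambda>m. cmod (\<psi> m)) F \<le> fock_norm \<psi>"
  using assms unfolding L2_set_def fock_norm_def fock_def
  by (auto intro!: real_sqrt_le_mono finite_sum_le_infsum)

lemma fock_mult_summable:
  assumes "\<phi> \<in> fock" "\<psi> \<in> fock"
  shows "(\<lambda>m. cmod (\<phi> m) * cmod (\<psi> m)) summable_on UNIV"
proof (rule summable_on_comparison_test)
  show "(\<lambda>m. (cmod (\<phi> m))\<^sup>2 + (cmod (\<psi> m))\<^sup>2) summable_on UNIV"
    using assms by (auto simp: fock_def intro!: summable_on_add)
  show "cmod (\<phi> m) * cmod (\<psi> m) \<le> (cmod (\<phi> m))\<^sup>2 + (cmod (\<psi> m))\<^sup>2" for m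
    using sum_squares_bound[of "cmod (\<phi> m)" "cmod (\<psi> m)"]
      mult_nonneg_nonneg[OF norm_ge_zero[of "\<phi> m"] norm_ge_zero[of "\<psi> m"]] by linarith
qed auto

text \<open>The finite inequality for \<open>L2_set\<close> bounds every finite partial sum, and a
  sum of nonnegative terms is the supremum of these.\<close>

lemma fock_Cauchy_Schwarz:
  assumes "\<phi> \<in> fock" "\<psi> \<in> fock"
  shows "(\<Sum>\<^sub>\<infinity>m. cmod (\<phi> m) * cmod (\<psi> m)) \<le> fock_norm \<phi> * fock_norm \<psi>"
proof (rule infsum_le_finite_sums[OF fock_mult_summable[OF assms]])
  fix F :: "('a \<Rightarrow> nat) set" assume "finite F"
  have "(\<Sum>m\<in>F. cmod (\<phi> m) * cmod (\<psi> m)) \<le> L2_set (\<lambda>m. cmod (\<phi> m)) F * L2_set (\<lambda>m. cmod (\<psi> m)) F"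
    using L2_set_mult_ineq[of "\<lambda>m. cmod (\<phi> m)" "\<lambda>m. cmod (\<psi> m)" F] by simp
  also have "\<dots> \<le> fock_norm \<phi> * fock_norm \<psi>"
    using \<open>finite F\<close> assms by (intro mult_mono L2_set_le_fock_norm fock_norm_nonneg L2_set_nonneg)
  finally show "(\<Sum>m\<in>F. cmod (\<phi> m) * cmod (\<psi> m)) \<le> fock_norm \<phi> * fock_norm \<psi>" .
qed

lemma fock_norm_triangle:
  assumes "\<phi> \<in> fock" "\<psi> \<in> fock"
  shows "fock_norm (\<lambda>m. \<phi> m + \<psi> m) \<le> fock_norm \<phi> + fock_norm \<psi>"
proof (rule power2_le_imp_le)
  have s: "(\<lambda>m. (cmod (\<phi> m))\<^sup>2) summable_on UNIV" "(\<lambda>m. (cmod (\<psi> m))\<^sup>2) summable_on UNIV"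
    using assms by (auto simp: fock_def)
  have "(fock_norm (\<lambda>m. \<phi> m + \<psi> m))\<^sup>2
      \<le> (\<Sum>\<^sub>\<infinity>m. ((cmod (\<phi> m))\<^sup>2 + (cmod (\<psi> m))\<^sup>2) + 2 * (cmod (\<phi> m) * cmod (\<psi> m)))"
    unfolding fock_norm_sq
  proof (rule infsum_mono)
    show "(\<lambda>m. (cmod (\<phi> m + \<psi> m))\<^sup>2) summable_on UNIV"
      using fock_add[OF assms] by (simp add: fock_def)
    show "(\<lambda>m. ((cmod (\<phi> m))\<^sup>2 + (cmod (\<psi> m))\<^sup>2) + 2 * (cmod (\<phi> m) * cmod (\<psi> m))) summable_on UNIV"
      using s fock_mult_summable[OF assms]
      by (intro summable_on_add summable_on_cmult_right) auto
    show "(cmod (\<phi> m + \<psi> m))\<^sup>2 \<le> ((cmod (\<phi> m))\<^sup>2 + (cmod (\<psi> m))\<^sup>2) + 2 * (cmod (\<phi> m) * cmod (\<psi> m))"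
      for m using power_mono[OF norm_triangle_ineq[of "\<phi> m" "\<psi> m"], of 2]
      by (simp add: power2_sum)
  qed
  also have "\<dots> = (fock_norm \<phi>)\<^sup>2 + (fock_norm \<psi>)\<^sup>2 + 2 * (\<Sum>\<^sub>\<infinity>m. cmod (\<phi> m) * cmod (\<psi> m))"
    using s fock_mult_summable[OF assms]
    by (simp add: infsum_add infsum_cmult_right' summable_on_add summable_on_cmult_right fock_norm_sq)
  also have "\<dots> \<le> (fock_norm \<phi> + fock_norm \<psi>)\<^sup>2"
    using fock_Cauchy_Schwarz[OF assms] by (simp add: power2_sum)
  finally show "(fock_norm (\<lambda>m. \<phi> m + \<psi> m))\<^sup>2 \<le> (fock_norm \<phi> + fock_norm \<psi>)\<^sup>2" .
qed (simp add: fock_norm_nonneg)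

lemma fock_norm_triangle_diff:
  assumes "\<phi> \<in> fock" "\<psi> \<in> fock"
  shows "fock_norm (\<lambda>m. \<phi> m - \<psi> m) \<le> fock_norm \<phi> + fock_norm \<psi>"
  using fock_norm_triangle[OF assms(1) fock_scale[OF assms(2), of "-1"]] fock_norm_scale[of "-1" \<psi>]
  by simp

lemma fock_norm_eq_0D:
  assumes "\<psi> \<in> fock" "fock_norm \<psi> = 0"
  shows "\<psi> m = 0"
proof -
  have "(\<Sum>\<^sub>\<infinity>m. (cmod (\<psi> m))\<^sup>2) \<le> 0"
    using fock_norm_sq[of \<psi>] assms(2) by simp
  then have "(cmod (\<psi> m))\<^sup>2 = 0"
    using assms(1) by (intro nonneg_infsum_le_0D[where f = "\<lambda>m. (cmod (\<psi> m))\<^sup>2" and A = UNIV]) (auto simp: fock_def)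
  then show ?thesis by simp
qed

text \<open>Only the real part enters the derivative of the squared norm along an orbit, and real
  summands can be compared and telescoped directly.\<close>

definition re_inner :: "'n state \<Rightarrow> 'n state \<Rightarrow> real" where
  "re_inner \<phi> \<psi> = (\<Sum>\<^sub>\<infinity>m. Re (cnj (\<phi> m) * \<psi> m))"

lemma re_inner_abs_summable:
  assumes "\<phi> \<in> fock" "\<psi> \<in> fock"
  shows "(\<lambda>m. \<bar>Re (cnj (\<phi> m) * \<psi> m)\<bar>) summable_on UNIV"
proof (rule summable_on_comparison_test[OF fock_mult_summable[OF assms]])
  show "\<bar>Re (cnj (\<phi> m) * \<psi> m)\<bar> \<le> cmod (\<phi> m) * cmod (\<psi> m)" for m
    using abs_Re_le_cmod[of "cnj (\<phi> m) * \<psi> m"] by (simp add: norm_mult)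
qed auto

lemma re_inner_summable:
  assumes "\<phi> \<in> fock" "\<psi> \<in> fock"
  shows "(\<lambda>m. Re (cnj (\<phi> m) * \<psi> m)) summable_on UNIV"
  using re_inner_abs_summable[OF assms] summable_on_iff_abs_summable_on_real by fastforce

lemma abs_re_inner_le:
  assumes "\<phi> \<in> fock" "\<psi> \<in> fock"
  shows "\<bar>re_inner \<phi> \<psi>\<bar> \<le> fock_norm \<phi> * fock_norm \<psi>"
proof -
  have "\<bar>re_inner \<phi> \<psi>\<bar> \<le> (\<Sum>\<^sub>\<infinity>m. \<bar>Re (cnj (\<phi> m) * \<psi> m)\<bar>)"
    unfolding re_inner_def
    using norm_infsum_bound[of "\<lambda>m. Re (cnj (\<phi> m) * \<psi> m)" UNIV] re_inner_abs_summable[OF assms] by simp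
  also have "\<dots> \<le> (\<Sum>\<^sub>\<infinity>m. cmod (\<phi> m) * cmod (\<psi> m))"
  proof (rule infsum_mono[OF re_inner_abs_summable[OF assms] fock_mult_summable[OF assms]])
    show "\<bar>Re (cnj (\<phi> m) * \<psi> m)\<bar> \<le> cmod (\<phi> m) * cmod (\<psi> m)" for m
      using abs_Re_le_cmod[of "cnj (\<phi> m) * \<psi> m"] by (simp add: norm_mult)
  qed
  finally show ?thesis
    using fock_Cauchy_Schwarz[OF assms] by linarith
qed

lemma re_inner_add:
  assumes "\<phi> \<in> fock" "\<psi> \<in> fock" "\<xi> \<in> fock"
  shows "re_inner \<phi> (\<lambda>m. \<psi> m + \<xi> m) = re_inner \<phi> \<psi> + re_inner \<phi> \<xi>"
  using infsum_add[OF re_inner_summable[OF assms(1,2)] re_inner_summable[OF assms(1,3)]]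
  by (simp add: re_inner_def algebra_simps)

lemma fock_norm_sq_add_scale:
  assumes "\<phi> \<in> fock" "\<psi> \<in> fock"
  shows "(fock_norm (\<lambda>m. \<phi> m + complex_of_real h * \<psi> m))\<^sup>2
       = (fock_norm \<phi>)\<^sup>2 + 2 * h * re_inner \<phi> \<psi> + h\<^sup>2 * (fock_norm \<psi>)\<^sup>2"
proof -
  have s: "(\<lambda>m. (cmod (\<phi> m))\<^sup>2) summable_on UNIV" "(\<lambda>m. (cmod (\<psi> m))\<^sup>2) summable_on UNIV"
    using assms by (auto simp: fock_def)
  have "(cmod (\<phi> m + complex_of_real h * \<psi> m))\<^sup>2
      = ((cmod (\<phi> m))\<^sup>2 + (2 * h) * Re (cnj (\<phi> m) * \<psi> m)) + h\<^sup>2 * (cmod (\<psi> m))\<^sup>2" for m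
    by (simp add: cmod_power2) (simp add: algebra_simps power2_eq_square)
  then show ?thesis
    using s re_inner_summable[OF assms] unfolding fock_norm_sq re_inner_def
    by (simp only: infsum_add infsum_cmult_right' summable_on_add summable_on_cmult_right)
qed

section \<open>Orbits of skew generators: conservation of the norm and uniqueness of the
  exponential\<close>

text \<open>The squared norm has derivative twice the real part of the inner product of
  \<open>u t\<close> with \<open>A (u t)\<close>, which vanishes by skewness.\<close>

lemma orbit_norm_const:
  assumes u: "orbit A u"
    and skew: "\<And>\<psi>. \<psi> \<in> op_domain A \<Longrightarrow> re_inner \<psi> (A \<psi>) = 0"
  shows "fock_norm (u t) = fock_norm (u 0)"
proof -
  have fu: "u t \<in> fock" "A (u t) \<in> fock" and sk: "re_inner (u t) (A (u t)) = 0" for t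
    using u skew[of "u t"] by (auto simp: orbit_def op_domain_def)
  have "((\<lambda>t. (fock_norm (u t))\<^sup>2) has_real_derivative 0) (at t)" for t
  proof -
    define e where "e h = (\<lambda>m. (u (t + h) m - u t m) / complex_of_real h - A (u t) m)" for h
    have fe: "e h \<in> fock" for h
      using fock_diff[OF fock_scale[OF fock_diff[OF fu(1) fu(1)], of "1 / complex_of_real h"] fu(2),
          of "t + h" t t]
      unfolding e_def by simp
    have e0: "((\<lambda>h. fock_norm (e h)) \<longlongrightarrow> 0) (at 0)"
      using u by (simp add: orbit_def e_def)
    \<comment> \<open>Write \<open>u (t + h)\<close> as \<open>u t + h * v\<close> with
      \<open>v = A (u t) + e h\<close> and expand the square. The part of the cross term along
      \<open>A (u t)\<close> vanishes by skewness; what remains is bounded by \<open>b h\<close>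
      through Cauchy-Schwarz and the triangle inequality.\<close>
    define b where "b h = 2 * (fock_norm (u t) * fock_norm (e h))
      + \<bar>h\<bar> * (fock_norm (A (u t)) + fock_norm (e h))\<^sup>2" for h
    have "(b \<longlongrightarrow> 2 * (fock_norm (u t) * 0) + \<bar>0\<bar> * (fock_norm (A (u t)) + 0)\<^sup>2) (at 0)"
      unfolding b_def by (intro tendsto_intros e0)
    then have b0: "(b \<longlongrightarrow> 0) (at 0)" by simp
    have "\<bar>((fock_norm (u (t + h)))\<^sup>2 - (fock_norm (u t))\<^sup>2) / h\<bar> \<le> b h" if "h \<noteq> 0" for h
    proof -
      define v where "v = (\<lambda>m. A (u t) m + e h m)"
      have fv: "v \<in> fock" unfolding v_def by (rule fock_add[OF fu(2) fe])
      have "u (t + h) = (\<lambda>m. u t m + complex_of_real h * v m)"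
        using that by (auto simp: v_def e_def fun_eq_iff)
      then have "(fock_norm (u (t + h)))\<^sup>2 - (fock_norm (u t))\<^sup>2
          = h * (2 * re_inner (u t) v + h * (fock_norm v)\<^sup>2)"
        using fock_norm_sq_add_scale[OF fu(1)[of t] fv, of h]
        by (simp add: algebra_simps power2_eq_square)
      then have "\<bar>((fock_norm (u (t + h)))\<^sup>2 - (fock_norm (u t))\<^sup>2) / h\<bar>
          = \<bar>2 * re_inner (u t) v + h * (fock_norm v)\<^sup>2\<bar>"
        using that by simp
      also have "re_inner (u t) v = re_inner (u t) (e h)"
        unfolding v_def using re_inner_add[OF fu(1)[of t] fu(2)[of t] fe] sk by simp
      also have "\<bar>2 * re_inner (u t) (e h) + h * (fock_norm v)\<^sup>2\<bar>
          \<le> 2 * \<bar>re_inner (u t) (e h)\<bar> + \<bar>h\<bar> * (fock_norm v)\<^sup>2"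
        by (rule order_trans[OF abs_triangle_ineq]) (simp add: abs_mult)
      also have "\<dots> \<le> b h"
        unfolding b_def v_def
        by (intro add_mono mult_left_mono abs_re_inner_le fu fe power_mono fock_norm_triangle
            fock_norm_nonneg) auto
      finally show ?thesis .
    qed
    then have "((\<lambda>h. ((fock_norm (u (t + h)))\<^sup>2 - (fock_norm (u t))\<^sup>2) / h) \<longlongrightarrow> 0) (at 0)"
      by (intro Lim_null_comparison[OF _ b0]) (auto simp: eventually_at_filter)
    then show ?thesis
      by (simp add: DERIV_def)
  qed
  then have "(fock_norm (u t))\<^sup>2 = (fock_norm (u 0))\<^sup>2"
    by (intro DERIV_isconst_all) auto
  then show ?thesis
    by (simp add: fock_norm_nonneg)
qed

lemma orbit_diff:
  assumes u: "orbit A u" and v: "orbit A v"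
    and lin: "\<And>\<phi> \<psi>. A (\<lambda>m. \<phi> m - \<psi> m) = (\<lambda>m. A \<phi> m - A \<psi> m)"
  shows "orbit A (\<lambda>t m. u t m - v t m)"
  unfolding orbit_def
proof (intro conjI allI)
  fix t
  have fu: "u t \<in> fock" "A (u t) \<in> fock" and fv: "v t \<in> fock" "A (v t) \<in> fock" for t
    using u v by (auto simp: orbit_def op_domain_def)
  show "(\<lambda>m. u t m - v t m) \<in> op_domain A"
    using fock_diff[OF fu(1) fv(1)] fock_diff[OF fu(2) fv(2)] by (simp add: op_domain_def lin)
  define e where "e w h = (\<lambda>m. (w (t + h) m - w t m) / complex_of_real h - A (w t) m)"
    for w :: "real \<Rightarrow> 'a state" and h
  have fe: "e w h \<in> fock" if "\<And>t. w t \<in> fock \<and> A (w t) \<in> fock" for w h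
    using fock_diff[OF fock_scale[OF fock_diff[of "w (t + h)" "w t"], of "1 / complex_of_real h"],
        of "A (w t)"] that
    unfolding e_def by simp
  have "((\<lambda>h. fock_norm (e u h) + fock_norm (e v h)) \<longlongrightarrow> 0 + 0) (at 0)"
    using u v by (intro tendsto_add) (auto simp: orbit_def e_def)
  then have lim: "((\<lambda>h. fock_norm (e u h) + fock_norm (e v h)) \<longlongrightarrow> 0) (at 0)" by simp
  have eq: "(u (t + h) m - v (t + h) m - (u t m - v t m)) / complex_of_real h - A (\<lambda>m. u t m - v t m) m
      = e u h m - e v h m" for h m
    by (simp add: e_def lin diff_divide_distrib)
  show "((\<lambda>h. fock_norm (\<lambda>m. (u (t + h) m - v (t + h) m - (u t m - v t m)) / complex_of_real h
      - A (\<lambda>m. u t m - v t m) m)) \<longlongrightarrow> 0) (at 0)"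
    unfolding eq
    using fock_norm_triangle_diff[OF fe fe] fu fv
    by (intro Lim_null_comparison[OF _ lim]) (auto simp: fock_norm_nonneg)
qed

text \<open>The constant sequence \<open>u\<close> witnesses existence. For uniqueness, the
  difference of an approximating orbit \<open>v k\<close> and \<open>u\<close> is again an orbit and
  keeps its norm, so convergence at time 0 forces convergence to \<open>u 1\<close> at time
  1.\<close>

lemma op_exp_eqI:
  assumes u: "orbit A u"
    and lin: "\<And>\<phi> \<psi>. A (\<lambda>m. \<phi> m - \<psi> m) = (\<lambda>m. A \<phi> m - A \<psi> m)"
    and skew: "\<And>\<psi>. \<psi> \<in> op_domain A \<Longrightarrow> re_inner \<psi> (A \<psi>) = 0"
  shows "op_exp A (u 0) = u 1"
  unfolding op_exp_def
proof (rule the_equality)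
  have fu: "u t \<in> fock" for t
    using u by (auto simp: orbit_def op_domain_def)
  show "u 1 \<in> fock \<and> (\<exists>v. (\<forall>k. orbit A (v k)) \<and>
          (\<lambda>k. fock_norm (\<lambda>m. v k 0 m - u 0 m)) \<longlonglongrightarrow> 0 \<and>
          (\<lambda>k. fock_norm (\<lambda>m. v k 1 m - u 1 m)) \<longlonglongrightarrow> 0)"
    using u fu by (intro conjI exI[of _ "\<lambda>_. u"]) (auto simp: fock_norm_def)
  fix \<phi>
  assume "\<phi> \<in> fock \<and> (\<exists>v. (\<forall>k. orbit A (v k)) \<and>
          (\<lambda>k. fock_norm (\<lambda>m. v k 0 m - u 0 m)) \<longlonglongrightarrow> 0 \<and>
          (\<lambda>k. fock_norm (\<lambda>m. v k 1 m - \<phi> m)) \<longlonglongrightarrow> 0)"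
  then obtain v where \<phi>: "\<phi> \<in> fock" and v: "\<And>k. orbit A (v k)"
    and v0: "(\<lambda>k. fock_norm (\<lambda>m. v k 0 m - u 0 m)) \<longlonglongrightarrow> 0"
    and v1: "(\<lambda>k. fock_norm (\<lambda>m. v k 1 m - \<phi> m)) \<longlonglongrightarrow> 0"
    by blast
  have fv: "v k t \<in> fock" for k t
    using v by (auto simp: orbit_def op_domain_def)
  have const: "fock_norm (\<lambda>m. v k 1 m - u 1 m) = fock_norm (\<lambda>m. v k 0 m - u 0 m)" for k
    using orbit_norm_const[OF orbit_diff[OF v[of k] u lin] skew, of 1] by simp
  \<comment> \<open>Triangle inequality through \<open>v k 1\<close>, with the distance of
    \<open>v k 1\<close> and \<open>u 1\<close> transported back to time 0 by
    \<open>const\<close>.\<close>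
  have "fock_norm (\<lambda>m. \<phi> m - u 1 m)
      \<le> fock_norm (\<lambda>m. v k 0 m - u 0 m) + fock_norm (\<lambda>m. v k 1 m - \<phi> m)" for k
    using fock_norm_triangle_diff[OF fock_diff[OF fv fu] fock_diff[OF fv \<phi>], of k 1 1 k 1] const[of k]
    by simp
  then have "fock_norm (\<lambda>m. \<phi> m - u 1 m) \<le> 0 + 0"
    by (intro LIMSEQ_le_const[OF tendsto_add[OF v0 v1]]) auto
  then have "fock_norm (\<lambda>m. \<phi> m - u 1 m) = 0"
    using fock_norm_nonneg[of "\<lambda>m. \<phi> m - u 1 m"] by simp
  then show "\<phi> = u 1"
    using fock_norm_eq_0D[OF fock_diff[OF \<phi> fu[of 1]]] by (simp add: fun_eq_iff)
qed

section \<open>Skew-symmetry of the squeezing generators\<close>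

text \<open>Over an initial segment the form of \<open>a\<^sup>2 - (a\<^sup>\<dagger>)\<^sup>2\<close> telescopes to two boundary terms of size
  \<open>O(N |f N|\<^sup>2)\<close>; they must tend to zero, since otherwise the harmonic series would converge.\<close>

lemma two_step_form_eq_0:
  fixes f :: "nat \<Rightarrow> complex"
  defines "t \<equiv> \<lambda>n. Re (cnj (f n) * (complex_of_real (sqrt (real (n + 1) * real (n + 2))) * f (n + 2)
                        - complex_of_real (sqrt (real n * real (n - 1))) * f (n - 2)))"
  assumes f: "summable (\<lambda>n. (cmod (f n))\<^sup>2)" and t: "summable t"
  shows "suminf t = 0"
proof -
  define b where "b n = sqrt (real (n + 1) * real (n + 2)) * Re (cnj (f n) * f (n + 2))" for n
  have b_le: "\<bar>b n\<bar> \<le> real (n + 2) * ((cmod (f n))\<^sup>2 + (cmod (f (n + 2)))\<^sup>2)" for n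
  proof -
    have "sqrt (real (n + 1) * real (n + 2)) \<le> sqrt (real (n + 2) * real (n + 2))"
      by (intro real_sqrt_le_mono mult_right_mono) auto
    then have "sqrt (real (n + 1) * real (n + 2)) \<le> real (n + 2)"
      by simp
    moreover have "\<bar>Re (cnj (f n) * f (n + 2))\<bar> \<le> (cmod (f n))\<^sup>2 + (cmod (f (n + 2)))\<^sup>2"
    proof -
      have "\<bar>Re (cnj (f n) * f (n + 2))\<bar> \<le> cmod (f n) * cmod (f (n + 2))"
        using abs_Re_le_cmod[of "cnj (f n) * f (n + 2)"] by (simp add: norm_mult)
      then show ?thesis
        using sum_squares_bound[of "cmod (f n)" "cmod (f (n + 2))"]
          mult_nonneg_nonneg[OF norm_ge_zero[of "f n"] norm_ge_zero[of "f (n + 2)"]] by linarith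
    qed
    ultimately show ?thesis
      unfolding b_def abs_mult by (intro mult_mono) auto
  qed
  \<comment> \<open>The real part is symmetric in its two arguments, so the lowering term at
    \<open>n + 2\<close> is the raising term at \<open>n\<close>.\<close>
  have t_eq: "t (n + 2) = b (n + 2) - b n" for n
    by (simp add: t_def b_def algebra_simps)
  have partial: "(\<Sum>n<N + 2. t n) = b N + b (N + 1)" for N
  proof (induction N)
    case 0
    \<comment> \<open>At 0 and 1 the factor of the lowering term is zero, so the truncated
      \<open>n - 2\<close> has no effect.\<close>
    have "t 0 = b 0" "t 1 = b 1" by (simp_all add: t_def b_def algebra_simps)
    then show ?case by (simp add: numeral_2_eq_2)
  next
    case (Suc N)
    have "(\<Sum>n<Suc N + 2. t n) = (\<Sum>n<N + 2. t n) + t (N + 2)" by simp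
    then show ?case using Suc t_eq[of N] by simp
  qed
  have lim: "(\<lambda>N. b N + b (N + 1)) \<longlonglongrightarrow> suminf t"
    using LIMSEQ_ignore_initial_segment[OF summable_LIMSEQ[OF t], of 2] unfolding partial .
  show ?thesis
  proof (rule ccontr)
    assume nz: "suminf t \<noteq> 0"
    define L where "L = \<bar>suminf t\<bar> / 2"
    have L: "0 < L" "L < \<bar>suminf t\<bar>" using nz by (auto simp: L_def)
    have ev: "\<forall>\<^sub>F N in sequentially. L < \<bar>b N + b (N + 1)\<bar>"
      using order_tendstoD(1)[OF tendsto_rabs[OF lim] L(2)] .
    \<comment> \<open>By \<open>b_le\<close> both boundary terms have weight at most
      \<open>N + 3\<close>, so together they are at most \<open>(N + 3) * d N\<close>, with
      \<open>d\<close> summable. A nonzero limit would make \<open>1 / (N + 3)\<close> eventually at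
      most \<open>d N / L\<close>.\<close>
    define d where "d N = ((cmod (f N))\<^sup>2 + (cmod (f (N + 2)))\<^sup>2)
      + ((cmod (f (N + 1)))\<^sup>2 + (cmod (f (N + 1 + 2)))\<^sup>2)" for N
    have sd: "summable (\<lambda>N. d N / L)"
      unfolding d_def by (intro summable_divide summable_add f summable_ignore_initial_segment)
    have "norm (inverse (of_nat (N + 3)) :: real) \<le> d N / L" if "L < \<bar>b N + b (N + 1)\<bar>" for N
    proof -
      have "L < \<bar>b N\<bar> + \<bar>b (N + 1)\<bar>" using that by linarith
      also have "\<dots> \<le> real (N + 3) * ((cmod (f N))\<^sup>2 + (cmod (f (N + 2)))\<^sup>2)
          + real (N + 3) * ((cmod (f (N + 1)))\<^sup>2 + (cmod (f (N + 1 + 2)))\<^sup>2)"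
        by (intro add_mono order_trans[OF b_le] mult_right_mono) auto
      also have "\<dots> = real (N + 3) * d N"
        by (simp add: d_def algebra_simps)
      finally show ?thesis
        using L(1) by (simp add: field_simps)
    qed
    then have "summable (\<lambda>N. inverse (of_nat (N + 3)) :: real)"
      by (intro summable_comparison_test_ev[OF _ sd] eventually_mono[OF ev])
    then show False
      using not_summable_harmonic[where 'a = real] summable_iff_shift[of "\<lambda>n. inverse (real n)" 3]
      by simp
  qed
qed

text \<open>The generator shifts mode \<open>j\<close> by two quanta. For \<open>m j < 2\<close> the
  truncated difference is multiplied by zero.\<close>

lemma squeeze_gen_apply:
  "squeeze_gen j s \<psi> m = complex_of_real (s / 2) *
     (complex_of_real (sqrt (real (m j + 1) * real (m j + 2))) * \<psi> (m(j := m j + 2))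
    - complex_of_real (sqrt (real (m j) * real (m j - 1))) * \<psi> (m(j := m j - 2)))"
proof -
  have "m j - Suc (Suc 0) = m j - 2" "Suc (Suc (m j)) = m j + 2" by simp_all
  then show ?thesis
    by (simp add: squeeze_gen_def ann_def cre_def real_sqrt_mult ac_simps)
qed

lemma squeeze_gen_diff:
  "squeeze_gen j s (\<lambda>m. \<phi> m - \<psi> m) = (\<lambda>m. squeeze_gen j s \<phi> m - squeeze_gen j s \<psi> m)"
  by (simp add: squeeze_gen_apply fun_eq_iff algebra_simps)

text \<open>The form is summed first over the occupation of mode \<open>j\<close> with all other
  modes fixed, where \<open>two_step_form_eq_0\<close> applies. Unconditional summability over all
  occupations, which holds because the state and its image are square summable, permits the iterated
  sum.\<close>

lemma squeeze_gen_skew: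
  assumes "\<psi> \<in> op_domain (squeeze_gen j s)"
  shows "re_inner \<psi> (squeeze_gen j s \<psi>) = 0"
proof (cases "s = 0")
  case True
  then show ?thesis by (simp add: re_inner_def squeeze_gen_apply)
next
  case False
  define F where "F m = Re (cnj (\<psi> m) * squeeze_gen j s \<psi> m)" for m
  \<comment> \<open>Splits an occupation into the other modes, encoded as \<open>a\<close> with
    \<open>a j = 0\<close>, and the occupation \<open>n\<close> of mode \<open>j\<close>.\<close>
  define h where "h = (\<lambda>(a, n). a(j := n) :: 'a \<Rightarrow> nat)"
  have bij: "bij_betw h ({a. a j = 0} \<times> UNIV) UNIV"
    by (rule bij_betwI[where g = "\<lambda>m. (m(j := 0), m j)"]) (auto simp: h_def)
  have dom: "\<psi> \<in> fock" "squeeze_gen j s \<psi> \<in> fock"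
    using assms by (auto simp: op_domain_def)
  have sF: "(\<lambda>(a, n). F (a(j := n))) summable_on ({a. a j = 0} \<times> UNIV)"
    using re_inner_summable[OF dom] summable_on_reindex_bij_betw[OF bij, of F]
    by (simp add: F_def[abs_def] h_def case_prod_unfold)
  have s\<psi>: "(\<lambda>(a, n). (cmod (\<psi> (a(j := n))))\<^sup>2) summable_on ({a. a j = 0} \<times> UNIV)"
    using dom(1) summable_on_reindex_bij_betw[OF bij, of "\<lambda>m. (cmod (\<psi> m))\<^sup>2"]
    by (simp add: fock_def h_def case_prod_unfold)
  have fib: "(\<Sum>\<^sub>\<infinity>n. F (a(j := n))) = 0" if a: "a j = 0" for a
  proof -
    define f where "f n = \<psi> (a(j := n))" for n
    define t where "t n = Re (cnj (f n) * (complex_of_real (sqrt (real (n + 1) * real (n + 2))) * f (n + 2)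
                        - complex_of_real (sqrt (real n * real (n - 1))) * f (n - 2)))" for n
    have Re_scale: "Re (cnj z * (complex_of_real c * w)) = c * Re (cnj z * w)" for z w c
      by (subst mult.left_commute) simp
    have Ft: "F (a(j := n)) = s / 2 * t n" for n
      unfolding F_def squeeze_gen_apply Re_scale t_def f_def by simp
    have st: "(\<lambda>n. F (a(j := n))) summable_on UNIV"
      using summable_on_SigmaD1[OF sF] a by simp
    have "summable (\<lambda>n. F (a(j := n)))"
      using st by (rule summable_on_imp_summable)
    \<comment> \<open>Division by \<open>s / 2\<close> is possible because \<open>s = 0\<close> has
      been treated separately.\<close>
    then have "summable t"
      using False unfolding Ft by (subst (asm) summable_cmult_iff) auto
    moreover have "summable (\<lambda>n. (cmod (f n))\<^sup>2)"
      using summable_on_imp_summable[OF summable_on_SigmaD1[OF s\<psi>, of a]] a by (simp add: f_def)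
    ultimately have "suminf t = 0"
      unfolding t_def by (intro two_step_form_eq_0)
    then have "(\<Sum>n. F (a(j := n))) = 0"
      unfolding Ft using suminf_mult[OF \<open>summable t\<close>, of "s / 2"] by simp
    then show ?thesis
      using sums_unique[OF has_sum_imp_sums[OF has_sum_infsum[OF st]]] by simp
  qed
  have "re_inner \<psi> (squeeze_gen j s \<psi>) = infsum F UNIV"
    by (simp only: re_inner_def F_def[abs_def])
  also have "\<dots> = (\<Sum>\<^sub>\<infinity>(a, n)\<in>{a. a j = 0} \<times> UNIV. F (a(j := n)))"
    using infsum_reindex_bij_betw[OF bij, of F] by (simp add: h_def case_prod_unfold)
  also have "\<dots> = (\<Sum>\<^sub>\<infinity>a\<in>{a. a j = 0}. \<Sum>\<^sub>\<infinity>n. F (a(j := n)))"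
    by (rule infsum_Sigma'_banach[OF sF, symmetric])
  also have "\<dots> = 0"
    by (rule infsum_0) (simp add: fib)
  finally show ?thesis .
qed

section \<open>Geometrically decaying states\<close>

text \<open>A slightly larger ratio absorbs a linear factor: by Bernoulli,
  \<open>(1 + d) ^ n\<close> dominates \<open>d * (n + 1)\<close>, and
  \<open>d = (1 - q) / 2\<close> is small enough to keep \<open>q * (1 + d)\<close> below 1.\<close>

lemma linear_times_geometric_le:
  fixes q :: real
  assumes "0 < q" "q < 1"
  obtains K p where "0 < K" "0 < p" "p < 1" "q \<le> p" "\<And>n. (real n + 1) * q ^ n \<le> K * p ^ n"
proof
  define d where "d = (1 - q) / 2"
  have d: "0 < d" "d \<le> 1" using assms by (auto simp: d_def)
  show "0 < 1 / d" "0 < q * (1 + d)" using d assms by auto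
  have "q * d < d" using assms d by simp
  moreover have "q + d < 1" using assms by (simp add: d_def field_simps)
  ultimately show "q * (1 + d) < 1" by (simp add: distrib_left)
  show "q \<le> q * (1 + d)" using d assms by simp
  fix n
  have "d * (real n + 1) \<le> 1 + real n * d"
    using d by (simp add: algebra_simps)
  also have "\<dots> \<le> (1 + d) ^ n"
    using d by (intro Bernoulli_inequality) auto
  finally have "real n + 1 \<le> (1 / d) * (1 + d) ^ n"
    using d by (simp add: field_simps)
  then have "(real n + 1) * q ^ n \<le> (1 / d) * (1 + d) ^ n * q ^ n"
    using assms by (intro mult_right_mono) auto
  then show "(real n + 1) * q ^ n \<le> 1 / d * (q * (1 + d)) ^ n"
    by (simp add: power_mult_distrib ac_simps)
qed

lemma geometric_summable:
  fixes q :: real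
  assumes "0 < q" "q < 1"
  shows "(\<lambda>m :: 'n :: finite \<Rightarrow> nat. q ^ (\<Sum>i\<in>UNIV. m i)) summable_on UNIV"
proof -
  have sums: "(\<lambda>n. q ^ n) sums (1 / (1 - q))"
    using assms by (intro geometric_sums) auto
  have hs: "((\<lambda>n. q ^ n) has_sum (1 / (1 - q))) UNIV"
    using assms by (intro norm_summable_imp_has_sum sums) (auto intro: summable_geometric)
  have "infsum (\<lambda>m :: 'n \<Rightarrow> nat. \<Prod>i\<in>UNIV. q ^ m i) (PiE UNIV (\<lambda>_. UNIV)) = (\<Prod>i\<in>(UNIV :: 'n set). infsum (\<lambda>n. q ^ n) UNIV)"
    using hs assms by (intro infsum_prod_PiE_abs) (auto simp: summable_on_def)
  \<comment> \<open>A non-summable family gets the value 0, so a nonzero value of the product of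
    geometric series certifies summability.\<close>
  then have "infsum (\<lambda>m :: 'n \<Rightarrow> nat. \<Prod>i\<in>UNIV. q ^ m i) UNIV \<noteq> 0"
    using assms by (simp add: infsumI[OF hs])
  then show ?thesis
    using infsum_not_exists by (auto simp: power_sum)
qed

text \<open>A common domain: closed under linear combinations and ladder operators and contained in
  \<open>fock\<close>, so every inner product formed from the probe by generators converges
  absolutely.\<close>

definition rapid :: "'n :: finite state \<Rightarrow> bool" where
  "rapid \<psi> \<longleftrightarrow> (\<exists>C q. 0 < q \<and> q < 1 \<and> (\<forall>m. cmod (\<psi> m) \<le> C * q ^ (\<Sum>i\<in>UNIV. m i)))"

lemma rapidI:
  assumes "0 < q" "q < 1" "\<And>m. cmod (\<psi> m) \<le> C * q ^ (\<Sum>i\<in>UNIV. m i)"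
  shows "rapid \<psi>"
  using assms unfolding rapid_def by blast

lemma rapidE:
  assumes "rapid \<psi>"
  obtains C q where "0 < q" "q < 1" "0 \<le> C" "\<And>m. cmod (\<psi> m) \<le> C * q ^ (\<Sum>i\<in>UNIV. m i)"
proof -
  from assms obtain C q where *: "0 < q" "q < 1" "\<And>m. cmod (\<psi> m) \<le> C * q ^ (\<Sum>i\<in>UNIV. m i)"
    unfolding rapid_def by blast
  have "0 \<le> C" using order_trans[OF norm_ge_zero *(3)[of "\<lambda>_. 0"]] by simp
  with * that show ?thesis by blast
qed

lemma rapid_add:
  assumes "rapid \<phi>" "rapid \<psi>"
  shows "rapid (\<lambda>m. \<phi> m + \<psi> m)"
proof -
  obtain C q where 1: "0 < q" "q < 1" "0 \<le> C" "\<And>m. cmod (\<phi> m) \<le> C * q ^ (\<Sum>i\<in>UNIV. m i)"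
    using assms(1) by (rule rapidE) blast
  obtain D p where 2: "0 < p" "p < 1" "0 \<le> D" "\<And>m. cmod (\<psi> m) \<le> D * p ^ (\<Sum>i\<in>UNIV. m i)"
    using assms(2) by (rule rapidE) blast
  show ?thesis
  proof (rule rapidI[of "max p q" _ "C + D"])
    fix m :: "'a \<Rightarrow> nat"
    have "cmod (\<phi> m + \<psi> m) \<le> C * q ^ (\<Sum>i\<in>UNIV. m i) + D * p ^ (\<Sum>i\<in>UNIV. m i)"
      using norm_triangle_ineq[of "\<phi> m" "\<psi> m"] 1(4)[of m] 2(4)[of m] by linarith
    also have "\<dots> \<le> C * max p q ^ (\<Sum>i\<in>UNIV. m i) + D * max p q ^ (\<Sum>i\<in>UNIV. m i)"
      using 1 2 by (intro add_mono mult_left_mono power_mono) auto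
    finally show "cmod (\<phi> m + \<psi> m) \<le> (C + D) * max p q ^ (\<Sum>i\<in>UNIV. m i)"
      by (simp add: algebra_simps)
  qed (use 1 2 in auto)
qed

lemma rapid_scale:
  assumes "rapid \<psi>"
  shows "rapid (\<lambda>m. c * \<psi> m)"
proof -
  obtain C q where 1: "0 < q" "q < 1" "0 \<le> C" "\<And>m. cmod (\<psi> m) \<le> C * q ^ (\<Sum>i\<in>UNIV. m i)"
    using assms(1) by (rule rapidE) blast
  show ?thesis
    by (rule rapidI[OF 1(1,2), of _ "cmod c * C"])
      (use mult_left_mono[OF 1(4) norm_ge_zero[of c]] in \<open>simp add: norm_mult mult.assoc\<close>)
qed

lemma rapid_diff: "rapid \<phi> \<Longrightarrow> rapid \<psi> \<Longrightarrow> rapid (\<lambda>m. \<phi> m - \<psi> m)"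
  using rapid_add[of \<phi> "\<lambda>m. -1 * \<psi> m"] rapid_scale[of \<psi> "-1"] by simp

lemma sum_fun_upd:
  fixes m :: "'n :: finite \<Rightarrow> nat"
  shows "(\<Sum>i\<in>UNIV. (m(j := k)) i) = k + (\<Sum>i\<in>UNIV - {j}. m i)"
  by (simp add: sum.remove[of UNIV j])

text \<open>Covers both ladder operators. Losing at most one quantum costs a factor
  \<open>1 / q\<close>, and the linear weight is absorbed by a larger ratio.\<close>

lemma rapid_weighted_shift:
  fixes \<psi> w :: "'n :: finite state" and g :: "('n \<Rightarrow> nat) \<Rightarrow> 'n \<Rightarrow> nat"
  assumes "rapid \<psi>"
    and w: "\<And>m. cmod (w m) \<le> real (\<Sum>i\<in>UNIV. m i) + 1"
    and g: "\<And>m. w m \<noteq> 0 \<Longrightarrow> (\<Sum>i\<in>UNIV. m i) \<le> (\<Sum>i\<in>UNIV. g m i) + 1"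
  shows "rapid (\<lambda>m. w m * \<psi> (g m))"
proof -
  obtain C q where 1: "0 < q" "q < 1" "0 \<le> C" "\<And>m. cmod (\<psi> m) \<le> C * q ^ (\<Sum>i\<in>UNIV. m i)"
    using assms(1) by (rule rapidE) blast
  obtain K p where 2: "0 < K" "0 < p" "p < 1" "\<And>n. (real n + 1) * q ^ n \<le> K * p ^ n"
    using linear_times_geometric_le[OF 1(1,2)] by metis
  show ?thesis
  proof (rule rapidI[OF 2(2,3), of _ "C / q * K"])
    fix m :: "'n \<Rightarrow> nat"
    define n where "n = (\<Sum>i\<in>UNIV. m i)"
    show "cmod (w m * \<psi> (g m)) \<le> C / q * K * p ^ (\<Sum>i\<in>UNIV. m i)"
    proof (cases "w m = 0")
      case True
      then show ?thesis using 1 2 by simp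
    next
      case False
      have "q * q ^ (\<Sum>i\<in>UNIV. g m i) \<le> q ^ n"
        using g[OF False] 1 unfolding n_def
        by (subst power_Suc[symmetric], intro power_decreasing) auto
      then have *: "q ^ (\<Sum>i\<in>UNIV. g m i) \<le> q ^ n / q"
        using 1 by (simp add: field_simps)
      have "cmod (w m * \<psi> (g m)) \<le> (real n + 1) * (C * q ^ (\<Sum>i\<in>UNIV. g m i))"
        unfolding norm_mult n_def by (intro mult_mono w 1) (auto simp del: of_nat_sum)
      also have "\<dots> \<le> (real n + 1) * (C * (q ^ n / q))"
        using 1 * by (intro mult_left_mono) auto
      also have "\<dots> = C / q * ((real n + 1) * q ^ n)" by simp
      also have "\<dots> \<le> C / q * (K * p ^ n)"
        using 1 2(4)[of n] by (intro mult_left_mono) auto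
      finally show ?thesis by (simp add: n_def)
    qed
  qed
qed

lemma sqrt_nat_le: "sqrt (real n) \<le> real n"
proof (cases n)
  case (Suc k)
  have "real (Suc k) * 1 \<le> real (Suc k) * real (Suc k)" by (intro mult_left_mono) auto
  then show ?thesis
    unfolding Suc by (intro real_le_lsqrt) (auto simp: power2_eq_square)
qed simp

lemma rapid_ann: "rapid \<psi> \<Longrightarrow> rapid (ann j \<psi>)"
  unfolding ann_def
proof (rule rapid_weighted_shift)
  fix m :: "'a \<Rightarrow> nat"
  have "m j \<le> (\<Sum>i\<in>UNIV. m i)" by (intro member_le_sum) auto
  then show "cmod (complex_of_real (sqrt (real (m j + 1)))) \<le> real (\<Sum>i\<in>UNIV. m i) + 1"
    using sqrt_nat_le[of "m j + 1"] by (simp del: of_nat_sum)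
  show "(\<Sum>i\<in>UNIV. m i) \<le> (\<Sum>i\<in>UNIV. (m(j := m j + 1)) i) + 1"
    using sum_fun_upd[of m j "m j + 1"] sum_fun_upd[of m j "m j"] by simp
qed

lemma rapid_cre: "rapid \<psi> \<Longrightarrow> rapid (cre j \<psi>)"
  unfolding cre_def
proof (rule rapid_weighted_shift)
  fix m :: "'a \<Rightarrow> nat"
  have "m j \<le> (\<Sum>i\<in>UNIV. m i)" by (intro member_le_sum) auto
  then show "cmod (complex_of_real (sqrt (real (m j)))) \<le> real (\<Sum>i\<in>UNIV. m i) + 1"
    using sqrt_nat_le[of "m j"] by (simp del: of_nat_sum)
  show "(\<Sum>i\<in>UNIV. m i) \<le> (\<Sum>i\<in>UNIV. (m(j := m j - 1)) i) + 1"
    using sum_fun_upd[of m j "m j - 1"] sum_fun_upd[of m j "m j"] by simp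
qed

text \<open>The constant \<open>C\<close> stays outside the norm, so a pointwise bound with
  \<open>C\<close> of order \<open>h\<close> at a fixed ratio yields norm convergence.\<close>

lemma geometric_bound_fock:
  fixes \<psi> :: "'n :: finite state"
  assumes "0 < q" "q < 1" "0 \<le> C" "\<And>m. cmod (\<psi> m) \<le> C * q ^ (\<Sum>i\<in>UNIV. m i)"
  shows "\<psi> \<in> fock"
    and "fock_norm \<psi> \<le> C * fock_norm (\<lambda>m :: 'n \<Rightarrow> nat. complex_of_real (q ^ (\<Sum>i\<in>UNIV. m i)))"
proof -
  have q2: "0 < q\<^sup>2" "q\<^sup>2 < 1"
    using assms by (auto simp: power_less_one_iff)
  have s: "(\<lambda>m :: 'n \<Rightarrow> nat. (C * q ^ (\<Sum>i\<in>UNIV. m i))\<^sup>2) summable_on UNIV"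
    using summable_on_cmult_right[OF geometric_summable[OF q2], of "C\<^sup>2"]
    by (simp add: power_mult_distrib power_mult[symmetric] mult.commute)
  have le: "(cmod (\<psi> m))\<^sup>2 \<le> (C * q ^ (\<Sum>i\<in>UNIV. m i))\<^sup>2" for m
    using assms(4)[of m] by (intro power_mono) auto
  show f: "\<psi> \<in> fock"
    unfolding fock_def using summable_on_comparison_test[OF s le] by simp
  have "fock_norm \<psi> \<le> fock_norm (\<lambda>m :: 'n \<Rightarrow> nat. complex_of_real C * complex_of_real (q ^ (\<Sum>i\<in>UNIV. m i)))"
    unfolding fock_norm_def
    using s le f assms(1,3)
    by (intro real_sqrt_le_mono infsum_mono) (auto simp: fock_def norm_mult norm_power)
  also have "\<dots> = C * fock_norm (\<lambda>m :: 'n \<Rightarrow> nat. complex_of_real (q ^ (\<Sum>i\<in>UNIV. m i)))"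
    using assms by (simp only: fock_norm_scale) simp
  finally show "fock_norm \<psi> \<le> C * fock_norm (\<lambda>m :: 'n \<Rightarrow> nat. complex_of_real (q ^ (\<Sum>i\<in>UNIV. m i)))" .
qed

lemma rapid_fock: "rapid \<psi> \<Longrightarrow> \<psi> \<in> fock"
  by (erule rapidE) (rule geometric_bound_fock)

section \<open>The squeezed vacuum of one mode\<close>

text \<open>One-mode squeezing generator at unit strength, acting on real amplitudes.\<close>

definition two_step :: "(nat \<Rightarrow> real) \<Rightarrow> nat \<Rightarrow> real" where
  "two_step f n = (sqrt (real (n + 1) * real (n + 2)) * f (n + 2)
                 - sqrt (real n * real (n - 1)) * f (n - 2)) / 2"

text \<open>The bounds \<open>D\<close> and \<open>p\<close> are uniform over \<open>Y\<close>,
  which allows second derivatives to be controlled on a whole interval of squeezing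
  parameters.\<close>

lemma two_step_bound:
  assumes "0 < q" "q < 1" "\<And>y n. y \<in> Y \<Longrightarrow> \<bar>f y n\<bar> \<le> C * q ^ n"
  obtains D p where "0 < p" "p < 1" "0 \<le> D" "\<And>y n. y \<in> Y \<Longrightarrow> \<bar>two_step (f y) n\<bar> \<le> D * p ^ n"
proof -
  obtain K p where 2: "0 < K" "0 < p" "p < 1" "\<And>n. (real n + 1) * q ^ n \<le> K * p ^ n"
    using linear_times_geometric_le[OF assms(1,2)] by metis
  have "\<bar>two_step (f y) n\<bar> \<le> (2 * \<bar>C\<bar> / q\<^sup>2 * K) * p ^ n" if y: "y \<in> Y" for y n
  proof -
    have f_le: "\<bar>f y n\<bar> \<le> \<bar>C\<bar> * q ^ n" for n
      using assms(1) order_trans[OF assms(3)[OF y, of n], of "\<bar>C\<bar> * q ^ n"] by (simp add: mult_right_mono)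
    \<comment> \<open>\<open>q ^ n / q\<^sup>2\<close> serves as a common bound for the decay at
      \<open>n + 2\<close> and at \<open>n - 2\<close>.\<close>
    have qq: "q ^ (n + 2) \<le> q ^ n / q\<^sup>2"
    proof -
      have "q ^ (n + 2) \<le> q ^ n" using assms(1,2) by (intro power_decreasing) auto
      also have "\<dots> * 1 \<le> q ^ n * (1 / q\<^sup>2)"
        using assms(1,2) by (intro mult_left_mono) (auto simp: field_simps power_le_one)
      finally show ?thesis by simp
    qed
    have 1: "\<bar>sqrt (real (n + 1) * real (n + 2)) * f y (n + 2)\<bar> \<le> real (n + 2) * (\<bar>C\<bar> * (q ^ n / q\<^sup>2))"
    proof -
      have "sqrt (real (n + 1) * real (n + 2)) \<le> sqrt (real (n + 2) * real (n + 2))"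
        by (intro real_sqrt_le_mono mult_right_mono) auto
      then have "sqrt (real (n + 1) * real (n + 2)) \<le> real (n + 2)" by simp
      moreover have "\<bar>f y (n + 2)\<bar> \<le> \<bar>C\<bar> * (q ^ n / q\<^sup>2)"
        using f_le[of "n + 2"] mult_left_mono[OF qq, of "\<bar>C\<bar>"] by linarith
      ultimately show ?thesis unfolding abs_mult by (intro mult_mono) auto
    qed
    have 2: "\<bar>sqrt (real n * real (n - 1)) * f y (n - 2)\<bar> \<le> real n * (\<bar>C\<bar> * (q ^ n / q\<^sup>2))"
    proof (cases "n < 2")
      case True
      then have "real n * real (n - 1) = 0" by (cases n) auto
      then show ?thesis using assms(1) by (simp only: real_sqrt_zero) simp
    next
      case False
      then obtain k where n: "n = k + 2" by (metis add.commute le_Suc_ex not_less)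
      have "sqrt (real n * real (n - 1)) \<le> sqrt (real n * real n)"
        by (intro real_sqrt_le_mono mult_left_mono) auto
      then have "sqrt (real n * real (n - 1)) \<le> real n" by simp
      moreover have "\<bar>f y (n - 2)\<bar> \<le> \<bar>C\<bar> * (q ^ n / q\<^sup>2)"
        using f_le[of k] assms(1) by (simp add: n power_add power2_eq_square field_simps)
      ultimately show ?thesis unfolding abs_mult by (intro mult_mono) auto
    qed
    have half: "\<bar>(A - B) / 2\<bar> \<le> (a + b) / 2" if "\<bar>A\<bar> \<le> a" "\<bar>B\<bar> \<le> b" for A B a b :: real
      using that by (simp add: abs_le_iff)
    have "\<bar>two_step (f y) n\<bar> \<le> (real (n + 2) * (\<bar>C\<bar> * (q ^ n / q\<^sup>2)) + real n * (\<bar>C\<bar> * (q ^ n / q\<^sup>2))) / 2"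
      using half[OF 1 2] unfolding two_step_def .
    also have "\<dots> = \<bar>C\<bar> / q\<^sup>2 * ((real n + 1) * q ^ n)"
      using assms(1) by (simp add: field_simps)
    also have "\<dots> \<le> \<bar>C\<bar> / q\<^sup>2 * (K * p ^ n)"
      using \<open>\<And>n. (real n + 1) * q ^ n \<le> K * p ^ n\<close>[of n] by (intro mult_left_mono) auto
    also have "\<dots> \<le> (2 * \<bar>C\<bar> / q\<^sup>2 * K) * p ^ n"
      using \<open>0 < K\<close> \<open>0 < p\<close> by (simp add: divide_right_mono mult_left_mono)
    finally show ?thesis .
  qed
  moreover have "0 \<le> 2 * \<bar>C\<bar> / q\<^sup>2 * K" using 2 by simp
  ultimately show ?thesis using that 2 by blast
qed

definition cb_weight :: "nat \<Rightarrow> real" where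
  "cb_weight k = (\<Prod>i<k. sqrt (real (2 * i + 1)) / sqrt (real (2 * i + 2)))"

lemma cb_weight_Suc: "sqrt (real (2 * k + 2)) * cb_weight (Suc k) = sqrt (real (2 * k + 1)) * cb_weight k"
  by (simp add: cb_weight_def)

lemma cb_weight_pos: "0 < cb_weight k"
  unfolding cb_weight_def by (intro prod_pos) auto

lemma cb_weight_le_1: "cb_weight k \<le> 1"
  unfolding cb_weight_def by (intro prod_le_1) (auto simp: divide_le_eq)

text \<open>The number-state amplitudes of the squeezed vacuum: \<open>cb_weight k\<close> is the square root of
  \<open>(2k choose k) / 4 ^ k\<close>.\<close>

definition sq_coeff :: "real \<Rightarrow> nat \<Rightarrow> real" where
  "sq_coeff y n = (if even n then cb_weight (n div 2) * (- tanh y) ^ (n div 2) / sqrt (cosh y) else 0)"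

lemma sq_coeff_0: "sq_coeff 0 n = (if n = 0 then 1 else 0)"
  by (auto simp: sq_coeff_def cb_weight_def elim!: evenE)

text \<open>The equation characterising the squeezed vacuum: annihilation equals
  \<open>- tanh y\<close> times creation. For odd \<open>n\<close> this is the recursion
  \<open>cb_weight_Suc\<close>; for even \<open>n\<close> both sides vanish, at \<open>n = 0\<close>
  through the factor \<open>sqrt 0\<close>.\<close>

lemma sq_coeff_ladder:
  "sqrt (real (n + 1)) * sq_coeff y (n + 1) = - tanh y * (sqrt (real n) * sq_coeff y (n - 1))"
proof (cases "odd n")
  case True
  then obtain k where n: "n = 2 * k + 1" by (rule oddE)
  have "sqrt (real (n + 1)) * sq_coeff y (n + 1)
      = (sqrt (real (2 * k + 2)) * cb_weight (Suc k)) * (- tanh y) ^ Suc k / sqrt (cosh y)"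
    by (simp add: n sq_coeff_def)
  also have "\<dots> = - tanh y * (sqrt (real n) * sq_coeff y (n - 1))"
    unfolding cb_weight_Suc by (simp add: n sq_coeff_def)
  finally show ?thesis .
qed (auto simp: sq_coeff_def elim!: evenE)

text \<open>Each factor \<open>tanh y\<close> accounts for two quanta, hence the square of
  \<open>q\<close>; the weight and \<open>1 / sqrt (cosh y)\<close> are at most 1.\<close>

lemma abs_sq_coeff_le:
  assumes "\<bar>tanh y\<bar> \<le> q\<^sup>2"
  shows "\<bar>sq_coeff y n\<bar> \<le> \<bar>q\<bar> ^ n"
proof (cases "even n")
  case True
  then obtain k where n: "n = 2 * k" by (rule evenE)
  have "1 \<le> sqrt (cosh y)" using cosh_real_ge_1[of y] by simp
  have "\<bar>sq_coeff y n\<bar> = cb_weight k * \<bar>tanh y\<bar> ^ k / sqrt (cosh y)"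
    using cb_weight_pos[of k] by (simp add: n sq_coeff_def abs_mult power_abs)
  also have "\<dots> \<le> 1 * \<bar>tanh y\<bar> ^ k / 1"
    using cb_weight_pos[of k] \<open>1 \<le> sqrt (cosh y)\<close>
    by (intro frac_le mult_mono cb_weight_le_1) auto
  also have "\<dots> \<le> (q\<^sup>2) ^ k"
    using assms by (simp add: power_mono)
  finally show ?thesis by (simp add: n power_mult)
qed (simp add: sq_coeff_def)

lemma tanh_le_square:
  fixes Y :: real
  obtains q where "0 < q" "q < 1" "\<And>y. \<bar>y\<bar> \<le> Y \<Longrightarrow> \<bar>tanh y\<bar> \<le> q\<^sup>2"
proof
  \<comment> \<open>The shift \<open>\<bar>Y\<bar> + 1\<close> gives a positive argument for every
    \<open>Y\<close>, so the square root lies strictly between 0 and 1.\<close>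
  have t: "0 < tanh (\<bar>Y\<bar> + 1)" "tanh (\<bar>Y\<bar> + 1) < 1"
    using tanh_real_pos_iff[of "\<bar>Y\<bar> + 1"] tanh_real_lt_1 by auto
  show "0 < sqrt (tanh (\<bar>Y\<bar> + 1))" "sqrt (tanh (\<bar>Y\<bar> + 1)) < 1" using t by auto
  fix y assume "\<bar>y\<bar> \<le> Y"
  then have "tanh \<bar>y\<bar> \<le> tanh (\<bar>Y\<bar> + 1)" by (subst tanh_real_le_iff) linarith
  then show "\<bar>tanh y\<bar> \<le> (sqrt (tanh (\<bar>Y\<bar> + 1)))\<^sup>2" using t by simp
qed

text \<open>The amplitudes solve the evolution equation of the generator. Differentiating the power
  of \<open>tanh\<close> gives the terms with factor \<open>k\<close>, and differentiating
  \<open>1 / sqrt (cosh y)\<close> gives the remaining half of \<open>x ^ (k + 1)\<close>.\<close>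

lemma DERIV_sq_coeff: "((\<lambda>y. sq_coeff y n) has_real_derivative two_step (sq_coeff y) n) (at y)"
proof (cases "even n")
  case False
  then have "two_step (sq_coeff y) n = 0"
    by (cases "n = 1") (auto simp: two_step_def sq_coeff_def)
  moreover have "(\<lambda>y. sq_coeff y n) = (\<lambda>_. 0)" using False by (simp add: sq_coeff_def fun_eq_iff)
  ultimately show ?thesis by simp
next
  case True
  then obtain k where n: "n = 2 * k" by (rule evenE)
  define x C where "x = - tanh y" and "C = cb_weight k / sqrt (cosh y)"
  have cpos: "0 < cosh y" by simp
  have up: "sqrt (real (n + 1) * real (n + 2)) * sq_coeff y (n + 2) = (2 * real k + 1) * (C * x ^ (k + 1))"
  proof -
    have "sqrt (real (n + 1) * real (n + 2)) * sq_coeff y (n + 2)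
        = sqrt (real (2 * k + 1)) * (sqrt (real (2 * k + 2)) * cb_weight (Suc k)) * x ^ (k + 1) / sqrt (cosh y)"
      by (simp add: n sq_coeff_def x_def real_sqrt_mult)
    then show ?thesis
      unfolding cb_weight_Suc by (simp add: C_def)
  qed
  have down: "sqrt (real n * real (n - 1)) * sq_coeff y (n - 2) = 2 * real k * (C * x ^ (k - 1))"
  proof (cases k)
    case 0
    then show ?thesis by (simp add: n)
  next
    case (Suc l)
    have "sqrt (real n * real (n - 1)) * sq_coeff y (n - 2)
        = sqrt (real (2 * l + 2)) * (sqrt (real (2 * l + 1)) * cb_weight l) * x ^ l / sqrt (cosh y)"
      by (simp add: n Suc sq_coeff_def x_def real_sqrt_mult)
    then show ?thesis
      unfolding cb_weight_Suc[symmetric] by (simp add: C_def Suc)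
  qed
  have "((\<lambda>y. cb_weight k * (- tanh y) ^ k / sqrt (cosh y)) has_real_derivative
      (cb_weight k * (real k * (- tanh y) ^ (k - 1) * (- (1 - (tanh y)\<^sup>2))) * sqrt (cosh y)
        - cb_weight k * (- tanh y) ^ k * (sinh y * (inverse (sqrt (cosh y)) / 2))) / (sqrt (cosh y) * sqrt (cosh y))) (at y)"
    using cpos by (auto intro!: derivative_eq_intros simp del: cosh_real_pos)
  also have "(cb_weight k * (real k * (- tanh y) ^ (k - 1) * (- (1 - (tanh y)\<^sup>2))) * sqrt (cosh y)
        - cb_weight k * (- tanh y) ^ k * (sinh y * (inverse (sqrt (cosh y)) / 2))) / (sqrt (cosh y) * sqrt (cosh y))
      = C * (x ^ k * x / 2 - real k * x ^ (k - 1) + real k * (x ^ (k - 1) * x\<^sup>2))"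
  proof -
    have *: "sinh y = - x * (sqrt (cosh y) * sqrt (cosh y))" "(tanh y)\<^sup>2 = x\<^sup>2" "- tanh y = x"
      using cpos by (simp_all add: x_def tanh_def)
    \<comment> \<open>With \<open>S\<close> for \<open>sqrt (cosh y)\<close> and
      \<open>sinh y = - x * S * S\<close>, the claim is a rational identity.\<close>
    have gen: "(w * (k * a * (- (1 - z))) * S - w * b * (- x * (S * S) * (inverse S / 2))) / (S * S)
        = w / S * (b * x / 2 - k * a + k * (a * z))" if "S \<noteq> 0" for w k a b S z :: real
      using that by (simp add: field_simps)
    show ?thesis
      unfolding C_def * using cpos by (intro gen) simp
  qed
  also have "\<dots> = two_step (sq_coeff y) n"
  proof -
    \<comment> \<open>The factor \<open>real k\<close> is kept because at \<open>k = 0\<close> the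
      exponent \<open>k - 1\<close> is truncated.\<close>
    have "real k * (x ^ (k - 1) * x\<^sup>2) = real k * (x ^ k * x)"
      by (cases k) (auto simp: power2_eq_square)
    then show ?thesis
      unfolding two_step_def up down by (simp add: field_simps)
  qed
  finally show ?thesis
    by (simp add: sq_coeff_def n)
qed

lemma DERIV_two_step:
  assumes "\<And>n. ((\<lambda>y. f y n) has_real_derivative g n) (at y)"
  shows "((\<lambda>y. two_step (f y) n) has_real_derivative two_step g n) (at y)"
  unfolding two_step_def by (auto intro!: derivative_eq_intros assms)

text \<open>The mean value inequality is used twice: for \<open>f'\<close>, and then for
  \<open>f z - z * f' y\<close>, whose derivative is the increment of \<open>f'\<close>.\<close>

lemma second_order_remainder:
  fixes f :: "real \<Rightarrow> real"
  assumes f: "\<And>z. \<bar>z - y\<bar> \<le> d \<Longrightarrow> (f has_real_derivative f' z) (at z)"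
    and f': "\<And>z. \<bar>z - y\<bar> \<le> d \<Longrightarrow> (f' has_real_derivative f'' z) (at z)"
    and B: "\<And>z. \<bar>z - y\<bar> \<le> d \<Longrightarrow> \<bar>f'' z\<bar> \<le> B"
    and h: "\<bar>h\<bar> \<le> d"
  shows "\<bar>f (y + h) - f y - h * f' y\<bar> \<le> B * h\<^sup>2"
proof -
  define S where "S = cball y \<bar>h\<bar>"
  have S: "\<bar>z - y\<bar> \<le> d \<and> \<bar>z - y\<bar> \<le> \<bar>h\<bar>" if "z \<in> S" for z
    using that h by (auto simp: S_def dist_real_def)
  have yS: "y \<in> S" "y + h \<in> S" "convex S" by (auto simp: S_def dist_real_def)
  have lip: "\<bar>f' z - f' y\<bar> \<le> B * \<bar>h\<bar>" if z: "z \<in> S" for z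
  proof -
    have "norm (f' z - f' y) \<le> B * norm (z - y)"
      using S B by (intro field_differentiable_bound[OF yS(3), of f' f''] z yS)
        (auto intro!: DERIV_subset[OF f'])
    also have "\<dots> \<le> B * \<bar>h\<bar>"
      using S[OF z] B[of z] by (intro mult_left_mono) auto
    finally show ?thesis by simp
  qed
  have "norm ((f (y + h) - (y + h) * f' y) - (f y - y * f' y)) \<le> (B * \<bar>h\<bar>) * norm (y + h - y)"
    using S lip
    by (intro field_differentiable_bound[OF yS(3), of "\<lambda>z. f z - z * f' y" "\<lambda>z. f' z - f' y"] yS)
      (auto intro!: derivative_eq_intros DERIV_subset[OF f])
  then show ?thesis
    by (simp add: algebra_simps power2_eq_square abs_mult_self_eq)
qed

text \<open>The second derivative in the squeezing parameter is \<open>two_step\<close> applied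
  twice, which decays geometrically uniformly for parameters within \<open>d\<close> of
  \<open>y\<close>.\<close>

lemma sq_coeff_remainder:
  obtains K p where "0 < p" "p < 1" "0 \<le> K"
    "\<And>h n. \<bar>h\<bar> \<le> d \<Longrightarrow> \<bar>sq_coeff (y + h) n - sq_coeff y n - h * two_step (sq_coeff y) n\<bar> \<le> K * h\<^sup>2 * p ^ n"
proof -
  define Y where "Y = {z. \<bar>z - y\<bar> \<le> d}"
  obtain q where q: "0 < q" "q < 1" "\<And>z. \<bar>z\<bar> \<le> \<bar>y\<bar> + d \<Longrightarrow> \<bar>tanh z\<bar> \<le> q\<^sup>2"
    using tanh_le_square by blast
  have 0: "\<bar>sq_coeff z n\<bar> \<le> 1 * q ^ n" if "z \<in> Y" for z n
    using abs_sq_coeff_le[OF q(3), of z n] that q(1) by (auto simp: Y_def)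
  obtain D p where 1: "0 < p" "p < 1" "0 \<le> D" "\<And>z n. z \<in> Y \<Longrightarrow> \<bar>two_step (sq_coeff z) n\<bar> \<le> D * p ^ n"
    using two_step_bound[OF q(1,2), of Y sq_coeff 1] 0 by metis
  obtain K r where 2: "0 < r" "r < 1" "0 \<le> K"
      "\<And>z n. z \<in> Y \<Longrightarrow> \<bar>two_step (two_step (sq_coeff z)) n\<bar> \<le> K * r ^ n"
    using two_step_bound[OF 1(1,2), of Y "\<lambda>z. two_step (sq_coeff z)" D] 1(4) by metis
  have "\<bar>sq_coeff (y + h) n - sq_coeff y n - h * two_step (sq_coeff y) n\<bar> \<le> (K * r ^ n) * h\<^sup>2"
    if "\<bar>h\<bar> \<le> d" for h n
    using 2(4) that
    by (intro second_order_remainder[where f = "\<lambda>y. sq_coeff y n"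
          and f' = "\<lambda>y. two_step (sq_coeff y) n" and f'' = "\<lambda>y. two_step (two_step (sq_coeff y)) n" and d = d]
        DERIV_sq_coeff DERIV_two_step) (auto simp: Y_def)
  then show ?thesis
    by (intro that[OF 2(1-3)]) (simp add: ac_simps)
qed

section \<open>The canonical probe\<close>

definition gauss :: "('n :: finite \<Rightarrow> real) \<Rightarrow> 'n state" where
  "gauss x m = complex_of_real (\<Prod>i\<in>UNIV. sq_coeff (x i) (m i))"

definition gauss_rest :: "('n :: finite \<Rightarrow> real) \<Rightarrow> 'n \<Rightarrow> ('n \<Rightarrow> nat) \<Rightarrow> real" where
  "gauss_rest x j m = (\<Prod>i\<in>UNIV - {j}. sq_coeff (x i) (m i))"

lemma gauss_split: "gauss (x(j := y)) m = complex_of_real (gauss_rest x j m * sq_coeff y (m j))"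
proof -
  have "(\<Prod>i\<in>UNIV - {j}. sq_coeff ((x(j := y)) i) (m i)) = gauss_rest x j m"
    unfolding gauss_rest_def by (intro prod.cong) auto
  then show ?thesis
    unfolding gauss_def by (simp add: prod.remove[of UNIV j])
qed

lemma gauss_split': "gauss x m = complex_of_real (gauss_rest x j m * sq_coeff (x j) (m j))"
  using gauss_split[of x j "x j"] by simp

lemma gauss_rest_upd: "gauss_rest x j (m(j := k)) = gauss_rest x j m"
  unfolding gauss_rest_def by (intro prod.cong) auto

lemma gauss_zero: "gauss (\<lambda>_. 0) = vacuum"
proof (rule ext)
  fix m :: "'a \<Rightarrow> nat"
  show "gauss (\<lambda>_. 0) m = vacuum m"
    by (cases "m = (\<lambda>_. 0)") (auto simp: gauss_def vacuum_def sq_coeff_0 fun_eq_iff)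
qed

lemma gauss_rest_bound:
  fixes x :: "'n :: finite \<Rightarrow> real"
  obtains q where "0 < q" "q < 1" "\<And>j m. \<bar>gauss_rest x j m\<bar> \<le> q ^ (\<Sum>i\<in>UNIV - {j}. m i)"
    "\<And>j n. \<bar>sq_coeff (x j) n\<bar> \<le> q ^ n"
proof -
  obtain q where q: "0 < q" "q < 1" "\<And>y. \<bar>y\<bar> \<le> (\<Sum>i\<in>UNIV. \<bar>x i\<bar>) \<Longrightarrow> \<bar>tanh y\<bar> \<le> q\<^sup>2"
    using tanh_le_square by blast
  have c: "\<bar>sq_coeff (x j) n\<bar> \<le> q ^ n" for j n
  proof -
    have "\<bar>x j\<bar> \<le> (\<Sum>i\<in>UNIV. \<bar>x i\<bar>)" by (intro member_le_sum) auto
    then show ?thesis using abs_sq_coeff_le[OF q(3), of "x j" n] q(1) by simp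
  qed
  have "\<bar>gauss_rest x j m\<bar> \<le> q ^ (\<Sum>i\<in>UNIV - {j}. m i)" for j m
    unfolding gauss_rest_def abs_prod power_sum by (intro prod_mono) (auto intro: c)
  with c q that show ?thesis by blast
qed

text \<open>Mode \<open>j\<close> may carry any geometrically bounded sequence, in particular the
  error of a difference quotient.\<close>

lemma rapid_rest_times:
  fixes x :: "'n :: finite \<Rightarrow> real"
  assumes "0 < q" "q < 1" "0 \<le> C" "\<And>n. \<bar>f n\<bar> \<le> C * q ^ n"
    and "0 < p" "p < 1" "\<And>m. \<bar>gauss_rest x j m\<bar> \<le> p ^ (\<Sum>i\<in>UNIV - {j}. m i)"
  shows "cmod (complex_of_real (gauss_rest x j m * f (m j))) \<le> C * max p q ^ (\<Sum>i\<in>UNIV. m i)"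
proof -
  have "cmod (complex_of_real (gauss_rest x j m * f (m j)))
      \<le> p ^ (\<Sum>i\<in>UNIV - {j}. m i) * (C * q ^ m j)"
    unfolding norm_of_real abs_mult using assms by (intro mult_mono) auto
  also have "\<dots> \<le> max p q ^ (\<Sum>i\<in>UNIV - {j}. m i) * (C * max p q ^ m j)"
    using assms by (intro mult_mono power_mono mult_nonneg_nonneg) auto
  also have "\<dots> = C * max p q ^ (\<Sum>i\<in>UNIV. m i)"
    by (simp add: sum.remove[of UNIV j] power_add)
  finally show ?thesis .
qed

lemma rapid_gauss: "rapid (gauss x)"
proof -
  obtain q where q: "0 < q" "q < 1" "\<And>j m. \<bar>gauss_rest x j m\<bar> \<le> q ^ (\<Sum>i\<in>UNIV - {j}. m i)"
    "\<And>j n. \<bar>sq_coeff (x j) n\<bar> \<le> q ^ n"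
    using gauss_rest_bound[of x] by blast
  have "cmod (gauss x m) \<le> 1 * q ^ (\<Sum>i\<in>UNIV. m i)" for m
    \<comment> \<open>Any mode can be split off; \<open>undefined\<close> is an arbitrary
      one.\<close>
    using rapid_rest_times[OF q(1,2) _ _ q(1-3), of 1 "sq_coeff (x undefined)" undefined m] q(4)
    unfolding gauss_split'[of x m undefined] by simp
  then show ?thesis
    by (rule rapidI[OF q(1,2)])
qed

lemma squeeze_gen_gauss:
  "squeeze_gen j s (gauss x) m
     = complex_of_real (gauss_rest x j m * (s * two_step (sq_coeff (x j)) (m j)))"
  unfolding squeeze_gen_apply gauss_split'[of x _ j] gauss_rest_upd two_step_def
  by (simp add: field_simps)

lemma rapid_squeeze_gen_gauss: "rapid (squeeze_gen j s (gauss x))"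
proof -
  have "squeeze_gen j s (gauss x)
      = (\<lambda>m. complex_of_real (s / 2) * (ann j (ann j (gauss x)) m - cre j (cre j (gauss x)) m))"
    by (simp add: squeeze_gen_def fun_eq_iff)
  then show ?thesis
    by (simp add: rapid_scale rapid_diff rapid_ann rapid_cre rapid_gauss del: of_real_divide)
qed

lemma orbit_gauss: "orbit (squeeze_gen j s) (\<lambda>t. gauss (x(j := x j + t * s)))"
  unfolding orbit_def
proof (intro conjI allI)
  fix t
  show "gauss (x(j := x j + t * s)) \<in> op_domain (squeeze_gen j s)"
    by (simp add: op_domain_def rapid_fock rapid_gauss rapid_squeeze_gen_gauss)
  define y where "y = x j + t * s"
  define c where "c h n = (sq_coeff (y + h * s) n - sq_coeff y n) / h - s * two_step (sq_coeff y) n" for h n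
  define e where "e h = (\<lambda>m. (gauss (x(j := x j + (t + h) * s)) m - gauss (x(j := x j + t * s)) m) / complex_of_real h
      - squeeze_gen j s (gauss (x(j := x j + t * s))) m)" for h
  have rest: "gauss_rest (x(j := z)) j = gauss_rest x j" for z
    unfolding gauss_rest_def fun_eq_iff by (auto intro!: prod.cong)
  \<comment> \<open>Only mode \<open>j\<close> moves along the orbit, so the error factorises into
    the fixed modes and the one-mode error \<open>c\<close>.\<close>
  have e_eq: "e h m = complex_of_real (gauss_rest x j m * c h (m j))" for h m
  proof -
    have arg: "x j + (t + h) * s = y + h * s" by (simp add: y_def distrib_right)
    show ?thesis
      unfolding e_def c_def squeeze_gen_gauss gauss_split rest arg y_def[symmetric] fun_upd_same
        of_real_mult of_real_diff of_real_divide
      by (simp add: right_diff_distrib diff_divide_distrib)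
  qed
  obtain K p where p: "0 < p" "p < 1" "0 \<le> K"
    "\<And>h n. \<bar>h\<bar> \<le> \<bar>s\<bar> \<Longrightarrow> \<bar>sq_coeff (y + h) n - sq_coeff y n - h * two_step (sq_coeff y) n\<bar> \<le> K * h\<^sup>2 * p ^ n"
    by (rule sq_coeff_remainder[of "\<bar>s\<bar>" y]) (rule that)
  obtain q where q: "0 < q" "q < 1" "\<And>j m. \<bar>gauss_rest x j m\<bar> \<le> q ^ (\<Sum>i\<in>UNIV - {j}. m i)"
    by (rule gauss_rest_bound[of x]) (rule that)
  have c_le: "\<bar>c h n\<bar> \<le> (\<bar>h\<bar> * (K * s\<^sup>2)) * p ^ n" if h: "h \<noteq> 0" "\<bar>h\<bar> \<le> 1" for h n
  proof -
    have "\<bar>h * s\<bar> \<le> \<bar>s\<bar>" using h by (simp add: abs_mult mult_left_le_one_le)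
    have "\<bar>c h n\<bar> = \<bar>sq_coeff (y + h * s) n - sq_coeff y n - (h * s) * two_step (sq_coeff y) n\<bar> / \<bar>h\<bar>"
      using h by (simp add: c_def abs_divide[symmetric] diff_divide_distrib)
    also have "\<dots> \<le> (K * (h * s)\<^sup>2 * p ^ n) / \<bar>h\<bar>"
      using p(4)[OF \<open>\<bar>h * s\<bar> \<le> \<bar>s\<bar>\<close>, of n] h by (intro divide_right_mono) auto
    also have "\<dots> = (\<bar>h\<bar> * (K * s\<^sup>2)) * p ^ n"
      using h by (simp add: power_mult_distrib power2_eq_square[of h] abs_if)
    finally show ?thesis .
  qed
  \<comment> \<open>Independent of \<open>h\<close>, so the norm of the error is of order
    \<open>h\<close>.\<close>
  define N where "N = fock_norm (\<lambda>m :: 'a \<Rightarrow> nat. complex_of_real (max q p ^ (\<Sum>i\<in>UNIV. m i)))"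
  have "fock_norm (e h) \<le> (\<bar>h\<bar> * (K * s\<^sup>2)) * N" if h: "h \<noteq> 0" "\<bar>h\<bar> \<le> 1" for h
    unfolding N_def
  proof (rule geometric_bound_fock(2))
    show "cmod (e h m) \<le> (\<bar>h\<bar> * (K * s\<^sup>2)) * max q p ^ (\<Sum>i\<in>UNIV. m i)" for m
      unfolding e_eq by (rule rapid_rest_times[OF p(1,2) _ c_le[OF h] q]) (use p in auto)
  qed (use p q in auto)
  then have ev: "\<forall>\<^sub>F h in at 0. norm (fock_norm (e h)) \<le> \<bar>h\<bar> * (K * s\<^sup>2) * N"
    by (auto simp: eventually_at fock_norm_nonneg intro!: exI[of _ 1])
  have "((\<lambda>h::real. \<bar>h\<bar> * (K * s\<^sup>2) * N) \<longlongrightarrow> 0) (at 0)"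
    by (auto intro!: tendsto_eq_intros)
  with ev have "((\<lambda>h. fock_norm (e h)) \<longlongrightarrow> 0) (at 0)"
    by (rule Lim_null_comparison)
  then show "((\<lambda>h. fock_norm (\<lambda>m. (gauss (x(j := x j + (t + h) * s)) m - gauss (x(j := x j + t * s)) m) / complex_of_real h
      - squeeze_gen j s (gauss (x(j := x j + t * s))) m)) \<longlongrightarrow> 0) (at 0)"
    unfolding e_def .
qed

lemma op_exp_squeeze_gauss: "op_exp (squeeze_gen j s) (gauss x) = gauss (x(j := x j + s))"
  using op_exp_eqI[OF orbit_gauss squeeze_gen_diff squeeze_gen_skew, of j s x] by simp

lemma probe_eq_gauss: "probe r = gauss (\<lambda>i. r $ i)"
proof -
  \<comment> \<open>Generalised to distinct lists: modes outside the list are still unsqueezed, so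
    distinctness makes each exponential raise its mode from 0 to \<open>r $ j\<close>.\<close>
  have "foldr (\<lambda>j T. op_exp (squeeze_gen j (r $ j)) \<circ> T) xs id vacuum
      = gauss (\<lambda>i. if i \<in> set xs then r $ i else 0)" if "distinct xs" for xs :: "'a list"
    using that
  proof (induction xs)
    case Nil
    then show ?case by (simp add: gauss_zero)
  next
    case (Cons j xs)
    then have "(\<lambda>i. if i \<in> set xs then r $ i else 0)(j := (if j \<in> set xs then r $ j else 0) + r $ j)
        = (\<lambda>i. if i \<in> set (j # xs) then r $ i else 0)"
      by (auto simp: fun_eq_iff)
    with Cons show ?case by (simp add: op_exp_squeeze_gauss)
  qed
  from this[of "sorted_list_of_set UNIV"] show ?thesis
    by (simp add: probe_def squeeze_def)
qed

section \<open>Fisher entries\<close>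

lemma rapid_mult_summable:
  assumes "rapid \<phi>" "rapid \<psi>"
  shows "(\<lambda>m. cnj (\<phi> m) * \<psi> m) summable_on UNIV"
proof (rule abs_summable_summable)
  show "(\<lambda>m. norm (cnj (\<phi> m) * \<psi> m)) summable_on UNIV"
    using fock_mult_summable[OF rapid_fock[OF assms(1)] rapid_fock[OF assms(2)]]
    by (simp add: norm_mult)
qed

lemma fock_inner_add_right:
  assumes "rapid \<phi>" "rapid \<psi>" "rapid \<xi>"
  shows "fock_inner \<phi> (\<lambda>m. \<psi> m + \<xi> m) = fock_inner \<phi> \<psi> + fock_inner \<phi> \<xi>"
  using infsum_add[OF rapid_mult_summable[OF assms(1,2)] rapid_mult_summable[OF assms(1,3)]]
  by (simp add: fock_inner_def distrib_left)

lemma fock_inner_scale_right: "fock_inner \<phi> (\<lambda>m. c * \<psi> m) = c * fock_inner \<phi> \<psi>"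
  by (simp add: fock_inner_def mult.left_commute infsum_cmult_right')

lemma fock_inner_commute: "fock_inner \<psi> \<phi> = cnj (fock_inner \<phi> \<psi>)"
  by (simp add: fock_inner_def mult.commute flip: infsum_cnj)

lemma fock_inner_diff_right:
  assumes "rapid \<phi>" "rapid \<psi>" "rapid \<xi>"
  shows "fock_inner \<phi> (\<lambda>m. \<psi> m - \<xi> m) = fock_inner \<phi> \<psi> - fock_inner \<phi> \<xi>"
  using fock_inner_add_right[OF assms(1,2) rapid_scale[OF assms(3), of "-1"]]
    fock_inner_scale_right[of \<phi> "-1" \<xi>] by simp

text \<open>Adding one quantum to mode \<open>j\<close> is a bijection onto the occupations with
  \<open>m j \<noteq> 0\<close>, and the created state vanishes at all others.\<close>

lemma fock_inner_cre: "fock_inner \<phi> (cre j \<psi>) = fock_inner (ann j \<phi>) \<psi>"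
proof -
  have bij: "bij_betw (\<lambda>m. m(j := m j + (1 :: nat))) UNIV {m. m j \<noteq> 0}"
    by (rule bij_betwI[where g = "\<lambda>m. m(j := m j - 1)"]) (auto simp: fun_eq_iff)
  have "fock_inner \<phi> (cre j \<psi>) = (\<Sum>\<^sub>\<infinity>m\<in>{m. m j \<noteq> 0}. cnj (\<phi> m) * cre j \<psi> m)"
    unfolding fock_inner_def by (rule infsum_cong_neutral) (auto simp: cre_def)
  also have "\<dots> = (\<Sum>\<^sub>\<infinity>m. cnj (\<phi> (m(j := m j + 1))) * cre j \<psi> (m(j := m j + 1)))"
    by (rule infsum_reindex_bij_betw[OF bij, symmetric])
  also have "\<dots> = fock_inner (ann j \<phi>) \<psi>"
    by (simp add: fock_inner_def ann_def cre_def mult.left_commute mult.commute)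
  finally show ?thesis .
qed

lemma fock_inner_ann: "fock_inner \<phi> (ann j \<psi>) = fock_inner (cre j \<phi>) \<psi>"
  by (metis fock_inner_cre fock_inner_commute)

lemma rapid_gen_op: "rapid \<psi> \<Longrightarrow> rapid (gen_op \<mu> \<psi>)"
  by (cases \<mu>) (simp_all add: rapid_cre rapid_ann rapid_add rapid_diff rapid_scale
      rapid_scale[of _ "-\<i>", simplified])

text \<open>The adjoint exchanges the two hopping terms. For \<open>BsY\<close> this changes the
  sign of their difference, compensated by conjugating the factor \<open>- \<i>\<close>.\<close>

lemma gen_op_hermitian:
  assumes "rapid \<phi>" "rapid \<psi>"
  shows "fock_inner \<phi> (gen_op \<mu> \<psi>) = fock_inner (gen_op \<mu> \<phi>) \<psi>"
proof -
  have hop: "fock_inner \<phi> (cre j (ann k \<psi>)) = fock_inner (cre k (ann j \<phi>)) \<psi>" for j k and \<phi> \<psi> :: "'a state"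
    by (simp add: fock_inner_cre fock_inner_ann)
  have rhop: "rapid (cre j (ann k \<phi>))" "rapid (cre j (ann k \<psi>))" for j k
    using assms by (simp_all add: rapid_cre rapid_ann)
  show ?thesis
  proof (cases \<mu>)
    case (Rot j)
    then show ?thesis by (simp add: hop)
  next
    case (BsX j k)
    have "fock_inner (gen_op \<mu> \<phi>) \<psi> = cnj (fock_inner \<psi> (gen_op \<mu> \<phi>))"
      by (rule fock_inner_commute)
    then show ?thesis
      using assms rhop
      by (simp add: BsX fock_inner_add_right hop[of \<psi>] fock_inner_commute[of "cre _ (ann _ \<psi>)"]
          add.commute)
  next
    case (BsY j k)
    have sub: "fock_inner \<phi> (gen_op \<mu> \<psi>) = - \<i> * (fock_inner \<phi> (cre j (ann k \<psi>)) - fock_inner \<phi> (cre k (ann j \<psi>)))"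
      if "rapid \<phi>" "rapid \<psi>" for \<phi> \<psi> :: "'a state"
      using that unfolding BsY gen_op.simps fock_inner_scale_right
      by (simp add: fock_inner_diff_right rapid_cre rapid_ann)
    have "fock_inner (gen_op \<mu> \<phi>) \<psi> = cnj (fock_inner \<psi> (gen_op \<mu> \<phi>))"
      by (rule fock_inner_commute)
    also have "\<dots> = \<i> * (cnj (fock_inner \<psi> (cre j (ann k \<phi>))) - cnj (fock_inner \<psi> (cre k (ann j \<phi>))))"
      unfolding sub[OF assms(2,1)] by simp
    also have "\<dots> = \<i> * (fock_inner (cre j (ann k \<phi>)) \<psi> - fock_inner (cre k (ann j \<phi>)) \<psi>)"
      by (simp only: fock_inner_commute[of "cre _ (ann _ \<phi>)" \<psi>])
    also have "\<dots> = fock_inner \<phi> (gen_op \<mu> \<psi>)"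
      unfolding sub[OF assms] hop by (simp add: algebra_simps)
    finally show ?thesis ..
  qed
qed

lemma expect_gen_op_real:
  assumes "rapid \<psi>"
  shows "cnj (expect \<psi> (gen_op \<mu>)) = expect \<psi> (gen_op \<mu>)"
  unfolding expect_def using gen_op_hermitian[OF assms assms, of \<mu>] fock_inner_commute by metis

lemma rapid_fluct: "rapid \<psi> \<Longrightarrow> rapid \<phi> \<Longrightarrow> rapid (fluct \<psi> (gen_op \<mu>) \<phi>)"
  unfolding fluct_def by (intro rapid_diff rapid_scale rapid_gen_op)

lemma fluct_hermitian:
  assumes "rapid \<psi>" "rapid \<phi>" "rapid \<xi>"
  shows "fock_inner \<phi> (fluct \<psi> (gen_op \<mu>) \<xi>) = fock_inner (fluct \<psi> (gen_op \<mu>) \<phi>) \<xi>"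
proof -
  have "fock_inner (fluct \<psi> (gen_op \<mu>) \<phi>) \<xi> = cnj (fock_inner \<xi> (fluct \<psi> (gen_op \<mu>) \<phi>))"
    by (rule fock_inner_commute)
  also have "\<dots> = cnj (fock_inner \<xi> (gen_op \<mu> \<phi>)) - expect \<psi> (gen_op \<mu>) * cnj (fock_inner \<xi> \<phi>)"
    unfolding fluct_def
    using assms by (simp add: fock_inner_diff_right rapid_scale rapid_gen_op fock_inner_scale_right expect_gen_op_real)
  also have "\<dots> = fock_inner (gen_op \<mu> \<phi>) \<xi> - expect \<psi> (gen_op \<mu>) * fock_inner \<phi> \<xi>"
    by (simp flip: fock_inner_commute)
  also have "\<dots> = fock_inner \<phi> (fluct \<psi> (gen_op \<mu>) \<xi>)"
    unfolding fluct_def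
    using assms by (simp add: fock_inner_diff_right rapid_scale rapid_gen_op fock_inner_scale_right gen_op_hermitian)
  finally show ?thesis ..
qed

lemma rapid_probe: "rapid (probe r)"
  by (simp add: probe_eq_gauss rapid_gauss)

text \<open>Moving one fluctuation to the left factor turns an entry into a symmetrised Gram entry
  of the centred generators applied to the probe.\<close>

lemma fisher_eq:
  "fisher r \<mu> \<nu> = 2 * (fock_inner (fluct (probe r) (gen_op \<mu>) (probe r)) (fluct (probe r) (gen_op \<nu>) (probe r))
                  + fock_inner (fluct (probe r) (gen_op \<nu>) (probe r)) (fluct (probe r) (gen_op \<mu>) (probe r)))"
  unfolding fisher_def expect_def[of _ "anticomm _ _"] anticomm_def
  by (simp add: fock_inner_add_right rapid_fluct rapid_probe fluct_hermitian)

lemma fisher_eq_0: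
  assumes "fluct (probe r) (gen_op \<nu>) (probe r) = (\<lambda>_. 0)"
  shows "fisher r \<mu> \<nu> = 0"
  unfolding fisher_eq assms by (simp add: fock_inner_def)

lemma fisher_diag_pos:
  assumes "fluct (probe r) (gen_op \<mu>) (probe r) m \<noteq> 0"
  shows "0 < fisher r \<mu> \<mu>"
proof -
  define \<phi> where "\<phi> = fluct (probe r) (gen_op \<mu>) (probe r)"
  have f: "\<phi> \<in> fock" unfolding \<phi>_def by (intro rapid_fock rapid_fluct rapid_probe)
  have "fock_inner \<phi> \<phi> = (\<Sum>\<^sub>\<infinity>m. complex_of_real ((cmod (\<phi> m))\<^sup>2))"
    unfolding fock_inner_def by (simp add: complex_norm_square mult.commute del: of_real_power)
  also have "\<dots> = complex_of_real ((fock_norm \<phi>)\<^sup>2)"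
    unfolding fock_norm_sq using f
    by (intro infsumI has_sum_of_real has_sum_infsum) (simp add: fock_def)
  finally have "fisher r \<mu> \<mu> = complex_of_real (4 * (fock_norm \<phi>)\<^sup>2)"
    by (simp add: fisher_eq \<phi>_def)
  moreover have "fock_norm \<phi> \<noteq> 0"
    using fock_norm_eq_0D[OF f] assms unfolding \<phi>_def by blast
  \<comment> \<open>In the order on complex numbers, positivity includes a vanishing imaginary
    part.\<close>
  ultimately show ?thesis
    by (simp add: less_complex_def del: of_real_mult of_real_power)
qed

section \<open>Generators acting on the probe\<close>

lemma ann_gauss: "ann j (gauss x) m = - complex_of_real (tanh (x j)) * cre j (gauss x) m"
proof -
  have "ann j (gauss x) m = complex_of_real (gauss_rest x j m * (sqrt (real (m j + 1)) * sq_coeff (x j) (m j + 1)))"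
    unfolding ann_def gauss_split'[of x _ j] gauss_rest_upd by simp
  also have "\<dots> = - complex_of_real (tanh (x j)) * cre j (gauss x) m"
    unfolding cre_def gauss_split'[of x _ j] gauss_rest_upd sq_coeff_ladder by simp
  finally show ?thesis .
qed

lemma cre_ann_gauss: "cre i (ann j (gauss x)) m = - complex_of_real (tanh (x j)) * cre i (cre j (gauss x)) m"
  unfolding cre_def[of i] ann_gauss by simp

lemma cre_commute: "cre i (cre j \<psi>) = cre j (cre i \<psi>)"
  by (cases "i = j") (simp_all add: cre_def fun_eq_iff fun_upd_twist[of i j] mult.left_commute)

lemma bsY_gauss: "x i = x j \<Longrightarrow> gen_op (BsY i j) (gauss x) = (\<lambda>_. 0)"
  by (simp add: cre_ann_gauss cre_commute[of i j])

lemma sq_coeff_eq_0_iff: "sq_coeff y n = 0 \<longleftrightarrow> odd n \<or> y = 0 \<and> n \<noteq> 0"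
proof -
  have "cb_weight k \<noteq> 0" for k
    using cb_weight_pos[of k] by simp
  moreover have "sqrt (cosh y) \<noteq> 0"
    using cosh_real_pos[of y] by simp
  ultimately show ?thesis
    by (cases "even n") (auto simp: sq_coeff_def elim!: evenE)
qed

lemma gauss_eq_0_iff: "gauss x m = 0 \<longleftrightarrow> (\<exists>i. odd (m i) \<or> x i = 0 \<and> m i \<noteq> 0)"
  by (simp add: gauss_def sq_coeff_eq_0_iff)

lemma fluct_bsY:
  assumes "r $ i = r $ j"
  shows "fluct (probe r) (gen_op (BsY i j)) (probe r) = (\<lambda>_. 0)"
  unfolding fluct_def expect_def probe_eq_gauss
  using assms by (simp only: bsY_gauss) (simp add: fock_inner_def)

lemma fisher_rot_pos:
  assumes "r $ j \<noteq> 0"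
  shows "0 < fisher r (Rot j) (Rot j)"
proof -
  define x where "x = (\<lambda>i. r $ i)"
  define c where "c = expect (gauss x) (gen_op (Rot j))"
  have number: "gen_op (Rot j) \<psi> m = of_nat (m j) * \<psi> m" for \<psi> and m :: "'a \<Rightarrow> nat"
    by (cases "m j") (simp_all add: ann_def cre_def fun_upd_idem mult.assoc[symmetric] flip: of_real_mult)
  have fl: "fluct (probe r) (gen_op (Rot j)) (probe r) m = (of_nat (m j) - c) * gauss x m" for m
    unfolding fluct_def probe_eq_gauss x_def[symmetric] c_def[symmetric] number by (simp add: algebra_simps)
  \<comment> \<open>Both occupations 0 and 2 of mode \<open>j\<close> have nonzero amplitude, and
    the mean \<open>c\<close> cannot equal both eigenvalues.\<close>
  have "gauss x (\<lambda>_. 0) \<noteq> 0" "gauss x ((\<lambda>_. 0)(j := 2)) \<noteq> 0"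
    using assms by (auto simp: gauss_eq_0_iff x_def)
  then have "fluct (probe r) (gen_op (Rot j)) (probe r) (\<lambda>_. 0) \<noteq> 0
      \<or> fluct (probe r) (gen_op (Rot j)) (probe r) ((\<lambda>_. 0)(j := 2)) \<noteq> 0"
    unfolding fl by auto
  then show ?thesis
    using fisher_diag_pos by blast
qed

lemma fisher_bsX_pos:
  assumes "i \<noteq> j" "r $ i = r $ j" "r $ j \<noteq> 0"
  shows "0 < fisher r (BsX i j) (BsX i j)"
proof (rule fisher_diag_pos)
  define x where "x = (\<lambda>i. r $ i)"
  \<comment> \<open>One quantum in each of the two modes: the probe has no amplitude at odd
    occupations, so the mean drops out and only the generator contributes.\<close>
  define m where "m = (\<lambda>_. 0)(i := 1, j := 1 :: nat)"
  have zero: "gauss x m = 0"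
    by (auto simp: gauss_eq_0_iff m_def intro!: exI[of _ j])
  have val: "gen_op (BsX i j) (gauss x) m = - 2 * complex_of_real (tanh (x j)) * gauss x (\<lambda>_. 0)"
  proof -
    \<comment> \<open>Equal squeezing makes the two hopping terms equal, so they add up
      here.\<close>
    have "cre j (ann i (gauss x)) m = cre i (ann j (gauss x)) m"
      unfolding cre_ann_gauss cre_commute[of j i] using assms(2) by (simp add: x_def)
    then have "gen_op (BsX i j) (gauss x) m = - 2 * complex_of_real (tanh (x j)) * cre i (cre j (gauss x)) m"
      by (simp add: cre_ann_gauss)
    also have "cre i (cre j (gauss x)) m = gauss x (\<lambda>_. 0)"
    proof -
      have "m i = 1" "m j = 1" "m(i := 0, j := 0) = (\<lambda>_. 0)"
        by (auto simp: m_def fun_eq_iff)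
      then show ?thesis
        using assms(1) by (simp add: cre_def)
    qed
    finally show ?thesis .
  qed
  show "fluct (probe r) (gen_op (BsX i j)) (probe r) m \<noteq> 0"
    unfolding fluct_def probe_eq_gauss x_def[symmetric] zero val
    using assms(3) by (simp add: gauss_eq_0_iff x_def)
qed

lemma card_bsY_directions:
  "card (bsY_directions :: 'n :: {finite, linorder} passive_gen set) = CARD('n) * (CARD('n) - 1) div 2"
proof -
  define L where "L = {(i, j). i < (j :: 'n)}"
  have im: "bsY_directions = (\<lambda>(i, j). BsY i j) ` L"
    by (auto simp: bsY_directions_def L_def)
  have c: "card (bsY_directions :: 'n passive_gen set) = card L"
    unfolding im by (rule card_image) (auto simp: inj_on_def)
  \<comment> \<open>A linear order splits all pairs into those above, below and on the diagonal; the
    first two are in bijection.\<close>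
  have "(UNIV :: ('n \<times> 'n) set) = L \<union> L\<inverse> \<union> Id"
    by (auto simp: L_def)
  then have "CARD('n \<times> 'n) = card (L \<union> L\<inverse> \<union> Id)"
    by (rule arg_cong)
  also have "\<dots> = card (L \<union> L\<inverse>) + card (Id :: ('n \<times> 'n) set)"
    by (rule card_Un_disjoint) (auto simp: L_def)
  also have "card (L \<union> L\<inverse>) = card L + card (L\<inverse>)"
    by (intro card_Un_disjoint) (auto simp: L_def)
  also have "(Id :: ('n \<times> 'n) set) = range (\<lambda>i. (i, i))"
    by auto
  also have "card (range (\<lambda>i :: 'n. (i, i))) = CARD('n)"
    by (rule card_image) (simp add: inj_on_def)
  finally have "CARD('n) * CARD('n) = 2 * card L + CARD('n)"
    by simp
  then have "CARD('n) * (CARD('n) - 1) = 2 * card L"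
    by (simp add: diff_mult_distrib2)
  then show ?thesis
    using c by simp
qed

theorem mainTheorem9:
  fixes r :: real and rs :: "real ^ 'n :: {finite, linorder}"
  assumes "CARD('n) \<ge> 2"
    and "\<And>j. rs $ j = r"
    and "r \<noteq> 0"
  shows "(\<forall>i j. i < j \<longrightarrow> fisher rs (BsY i j) (BsY i j) = 0) \<and>
         card (bsY_directions :: 'n passive_gen set) = CARD('n) * (CARD('n) - 1) div 2 \<and>
         (\<forall>\<kappa> \<in> bsY_directions. fisher_null rs \<kappa>) \<and>
         (\<forall>j. 0 < fisher rs (Rot j) (Rot j)) \<and>
         (\<forall>i j. i < j \<longrightarrow> 0 < fisher rs (BsX i j) (BsX i j))"
proof (intro conjI allI impI ballI)
  \<comment> \<open>The whole column vanishes, not only its diagonal entry, as kernel membership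
    over all passive generators demands.\<close>
  have null: "fisher rs \<mu> (BsY i j) = 0" for \<mu> i j
    by (intro fisher_eq_0 fluct_bsY) (simp add: assms(2))
  then show "fisher rs (BsY i j) (BsY i j) = 0" for i j .
  show "fisher_null rs \<kappa>" if "\<kappa> \<in> bsY_directions" for \<kappa>
    using that null by (auto simp: fisher_null_def passive_basis_def bsY_directions_def intro!: sum.neutral)
  show "0 < fisher rs (Rot j) (Rot j)" for j
    by (rule fisher_rot_pos) (simp add: assms)
  show "0 < fisher rs (BsX i j) (BsX i j)" if "i < j" for i j
    by (rule fisher_bsX_pos) (use that assms in auto)
qed (rule card_bsY_directions)

end
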